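(* Let $\lambda>0$, $s\in[0,1]$ and $(\mathbf G,\mathbf G')\sim\mathcal G(n,\lambda/n,s)$ with planted permutation $\boldsymbol\sigma^*$. Let $c>0$ with $c\log\lambda<1/4$, $d=\lfloor c\log n\rfloor$, $\gamma\in(0,c\log(\lambda s))$ and $\beta=\exp(n^\gamma)$, and let $\boldsymbol{\mathcal M}$ be the output of MPAlign on $(\mathbf G,\mathbf G')$ with parameters $d,\beta$. Then $\mathrm{err}(n):=\frac1n\sum_{i=1}^n\mathbf 1\{\exists u\ne\boldsymbol\sigma^*(i),\ (i,u)\in\boldsymbol{\mathcal M}\}$ tends to $0$ in probability as $n\to\infty$.
   Context: Graph model $\mathcal G(n,\lambda/n,s)$: $\{(\mathbf A_{ij},\tilde{\mathbf A}_{ij})\}_{i<j\in[n]}$ i.i.d. with $(1,1),(1,0),(0,1),(0,0)$ having probabilities $\lambda s/n,\lambda(1-s)/n,\lambda(1-s)/n,1-\lambda(2-s)/n$; $\boldsymbol\sigma^*$ uniform on permutations of $[n]$, independent; $\mathbf G$ has adjacency matrix $\mathbf A$ and $\mathbf G'$ adjacency $\mathbf A'$ with $\mathbf A'_{\boldsymbol\sigma^*(i)\boldsymbol\sigma^*(j)}=\tilde{\mathbf A}_{ij}$. MPAlign (inputs $G,G'$ on $[n]$, depth $d\ge1$, threshold $\beta$): let $\psi(m,a,b)=e^{\lambda s}s^m(1-s)^{a+b-2m}/(\lambda^m m!)$; $d_i,d'_u$ are degrees in $G,G'$. For adjacent $i,j$ in $G$ and adjacent $u,v$ in $G'$, $L_0(i\leftarrow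 j,u\leftarrow v)=1$ and for $k\ge1$, $L_k(i\leftarrow j,u\leftarrow v)=\sum_{m=0}^{(d_i\wedge d'_u)-1}\psi(m,d_i-1,d'_u-1)\sum_{\sigma,\sigma'}\prod_{\ell=1}^m L_{k-1}(\sigma(\ell)\leftarrow i,\sigma'(\ell)\leftarrow u)$, with $\sigma$ (resp. $\sigma'$) ranging over injections from $[m]$ into $\mathcal N_G(i)\setminus\{j\}$ (resp. $\mathcal N_{G'}(u)\setminus\{v\}$). The output $\mathcal M$ is the set of pairs $(i,u)$ such that the balls of radius $d$ around $i$ in $G$ and around $u$ in $G'$ contain no cycle, and there exist distinct neighbors $j_1,j_2,j_3$ of $i$ in $G$ and distinct neighbors $v_1,v_2,v_3$ of $u$ in $G'$ with $L_{d-1}(j_t\leftarrow i,v_t\leftarrow u)>\beta$ for $t=1,2,3$. *)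

theory Defs
  imports "HOL-Probability.Probability"
begin

type_synonym graph = "nat \<Rightarrow> nat \<Rightarrow> bool"

text \<open>
  A graph on the vertex set \<open>{1..n}\<close> is given by its adjacency relation, which is
  symmetric, irreflexive and false outside \<open>{1..n}\<close>.
\<close>

definition nbrs :: "graph \<Rightarrow> nat \<Rightarrow> nat set" where
  "nbrs G i = {j. G i j}"

definition deg :: "graph \<Rightarrow> nat \<Rightarrow> nat" where
  "deg G i = card (nbrs G i)"

definition ball_graph :: "graph \<Rightarrow> nat \<Rightarrow> nat \<Rightarrow> nat set" where
  "ball_graph G i d = {x. \<exists>k\<le>d. (G ^^ k) i x}"

text \<open>A cycle is listed by its vertices, without repeating the starting point.\<close>

definition is_cycle :: "graph \<Rightarrow> nat list \<Rightarrow> bool" where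
  "is_cycle G xs \<longleftrightarrow> 3 \<le> length xs \<and> distinct xs \<and>
     (\<forall>k<length xs. G (xs ! k) (xs ! (Suc k mod length xs)))"

definition ball_acyclic :: "graph \<Rightarrow> nat \<Rightarrow> nat \<Rightarrow> bool" where
  "ball_acyclic G i d \<longleftrightarrow> \<not> (\<exists>xs. set xs \<subseteq> ball_graph G i d \<and> is_cycle G xs)"

definition psi :: "real \<Rightarrow> real \<Rightarrow> nat \<Rightarrow> nat \<Rightarrow> nat \<Rightarrow> real" where
  "psi lam s m a b =
     exp (lam * s) * s ^ m * (1 - s) ^ (a + b - 2 * m) / (lam ^ m * fact m)"

definition injections :: "nat \<Rightarrow> nat set \<Rightarrow> (nat \<Rightarrow> nat) set" where
  "injections m B = {f \<in> {1..m} \<rightarrow>\<^sub>E B. inj_on f {1..m}}"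

text \<open>
  \<open>msg lam s G G' k i j u v\<close> is the message \<open>L\<^sub>k(i \<leftarrow> j, u \<leftarrow> v)\<close>; it is only meaningful
  when \<open>i, j\<close> are adjacent in \<open>G\<close> and \<open>u, v\<close> are adjacent in \<open>G'\<close>, so that both degrees
  are positive and the truncated subtractions are genuine.
\<close>

primrec msg ::
  "real \<Rightarrow> real \<Rightarrow> graph \<Rightarrow> graph \<Rightarrow> nat \<Rightarrow> nat \<Rightarrow> nat \<Rightarrow> nat \<Rightarrow> nat \<Rightarrow> real" where
  "msg lam s G G' 0 i j u v = 1"
| "msg lam s G G' (Suc k) i j u v =
     (\<Sum>m = 0..min (deg G i) (deg G' u) - 1. psi lam s m (deg G i - 1) (deg G' u - 1) *
        (\<Sum>\<sigma> \<in> injections m (nbrs G i - {j}). \<Sum>\<sigma>' \<in> injections m (nbrs G' u - {v}).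
           \<Prod>l = 1..m. msg lam s G G' k (\<sigma> l) i (\<sigma>' l) u))"

definition MPAlign ::
  "real \<Rightarrow> real \<Rightarrow> nat \<Rightarrow> graph \<Rightarrow> graph \<Rightarrow> nat \<Rightarrow> real \<Rightarrow> (nat \<times> nat) set" where
  "MPAlign lam s n G G' d \<beta> = {(i, u). i \<in> {1..n} \<and> u \<in> {1..n} \<and>
     ball_acyclic G i d \<and> ball_acyclic G' u d \<and>
     (\<exists>j v. inj_on j {1..3} \<and> inj_on v {1..3} \<and>
        (\<forall>t\<in>{1..3::nat}. j t \<in> nbrs G i \<and> v t \<in> nbrs G' u \<and>
           msg lam s G G' (d - 1) (j t) i (v t) u > \<beta>))}"

text \<open>
  The four weights form a probability distribution as soon as \<open>lam * (2 - s) \<le> n\<close>;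
  for smaller \<open>n\<close> the model does not exist and \<open>edge_pmf\<close> is unspecified.
\<close>

definition edge_pmf :: "nat \<Rightarrow> real \<Rightarrow> real \<Rightarrow> (bool \<times> bool) pmf" where
  "edge_pmf n lam s = embed_pmf (\<lambda>x. case x of
       (True, True) \<Rightarrow> lam * s / real n
     | (True, False) \<Rightarrow> lam * (1 - s) / real n
     | (False, True) \<Rightarrow> lam * (1 - s) / real n
     | (False, False) \<Rightarrow> 1 - lam * (2 - s) / real n)"

lemma pmf_edge_pmf:
  assumes "lam > 0" "0 \<le> s" "s \<le> 1" "lam * (2 - s) \<le> real n" "n > 0"
  shows "pmf (edge_pmf n lam s) (True, True) = lam * s / real n"
    and "pmf (edge_pmf n lam s) (True, False) = lam * (1 - s) / real n"
    and "pmf (edge_pmf n lam s) (False, True) = lam * (1 - s) / real n"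
    and "pmf (edge_pmf n lam s) (False, False) = 1 - lam * (2 - s) / real n"
proof -
  define f where "f = (\<lambda>x. case x of
       (True, True) \<Rightarrow> lam * s / real n
     | (True, False) \<Rightarrow> lam * (1 - s) / real n
     | (False, True) \<Rightarrow> lam * (1 - s) / real n
     | (False, False) \<Rightarrow> 1 - lam * (2 - s) / real n)"
  have nonneg: "0 \<le> f x" for x
    using assms by (cases x) (auto simp: f_def split: bool.splits)
  have U: "(UNIV :: (bool \<times> bool) set) =
      {(True, True), (True, False), (False, True), (False, False)}"
    by auto
  have "(\<Sum>x\<in>UNIV. f x) = 1"
    using assms unfolding U by (simp add: f_def field_simps)
  then have "(\<integral>\<^sup>+x. ennreal (f x) \<partial>count_space UNIV) = 1"
    using nonneg by (simp add: nn_integral_count_space_finite sum_ennreal)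
  then have "pmf (edge_pmf n lam s) x = f x" for x
    unfolding edge_pmf_def f_def[symmetric] using nonneg by (intro pmf_embed_pmf)
  then show "pmf (edge_pmf n lam s) (True, True) = lam * s / real n"
    and "pmf (edge_pmf n lam s) (True, False) = lam * (1 - s) / real n"
    and "pmf (edge_pmf n lam s) (False, True) = lam * (1 - s) / real n"
    and "pmf (edge_pmf n lam s) (False, False) = 1 - lam * (2 - s) / real n"
    by (simp_all add: f_def)
qed

text \<open>
  A sample is a pair \<open>(X, \<sigma>)\<close>: \<open>X (i, j)\<close> for \<open>i < j\<close> holds the two entries with index
  \<open>ij\<close> of the pair of aligned adjacency matrices, and \<open>\<sigma>\<close> is the planted permutation.
\<close>

type_synonym sample = "(nat \<times> nat \<Rightarrow> bool \<times> bool) \<times> (nat \<Rightarrow> nat)"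

definition corr_graphs :: "nat \<Rightarrow> real \<Rightarrow> real \<Rightarrow> sample pmf" where
  "corr_graphs n lam s = pair_pmf
     (Pi_pmf {(i, j). 1 \<le> i \<and> i < j \<and> j \<le> n} (False, False) (\<lambda>_. edge_pmf n lam s))
     (pmf_of_set {\<sigma>. \<sigma> permutes {1..n}})"

definition sym_adj :: "nat \<Rightarrow> (nat \<times> nat \<Rightarrow> bool) \<Rightarrow> graph" where
  "sym_adj n e i j \<longleftrightarrow> i \<in> {1..n} \<and> j \<in> {1..n} \<and> i \<noteq> j \<and> e (min i j, max i j)"

definition graph1 :: "nat \<Rightarrow> sample \<Rightarrow> graph" where
  "graph1 n \<omega> = sym_adj n (fst \<circ> fst \<omega>)"

definition graph2_aligned :: "nat \<Rightarrow> sample \<Rightarrow> graph" where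
  "graph2_aligned n \<omega> = sym_adj n (snd \<circ> fst \<omega>)"

definition planted :: "sample \<Rightarrow> nat \<Rightarrow> nat" where
  "planted \<omega> = snd \<omega>"

definition graph2 :: "nat \<Rightarrow> sample \<Rightarrow> graph" where
  "graph2 n \<omega> u v = graph2_aligned n \<omega> (inv (planted \<omega>) u) (inv (planted \<omega>) v)"

lemma graph2_planted:
  assumes "planted \<omega> permutes {1..n}"
  shows "graph2 n \<omega> (planted \<omega> i) (planted \<omega> j) = graph2_aligned n \<omega> i j"
  using assms by (simp add: graph2_def permutes_inverses)

definition err :: "real \<Rightarrow> real \<Rightarrow> nat \<Rightarrow> nat \<Rightarrow> real \<Rightarrow> sample \<Rightarrow> real" where
  "err lam s n d \<beta> \<omega> = 1 / real n * (\<Sum>i = 1..n.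
     of_bool (\<exists>u. u \<noteq> planted \<omega> i \<and>
       (i, u) \<in> MPAlign lam s n (graph1 n \<omega>) (graph2 n \<omega>) d \<beta>))"

end

theory Submission
  imports Defs "HOL-Real_Asymp.Real_Asymp"
begin

text \<open>
  Relabelling by the planted permutation, one may compare vertices \<open>i \<noteq> i'\<close> of two aligned graphs.
  Suppose \<open>(i, i')\<close> is selected, with neighbours \<open>j\<^sub>t\<close> and \<open>v\<^sub>t\<close>, \<open>t = 1, 2, 3\<close>. If for some \<open>t\<close> the trees
  explored behind \<open>j\<^sub>t\<close> and \<open>v\<^sub>t\<close> are disjoint, they are nearly independent and the message is a
  likelihood ratio of mean close to \<open>1\<close>, so by Markov's inequality it exceeds \<open>exp (n powr \<gamma>)\<close> with a
  probability that survives a union bound over all quadruples of vertices.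
  Otherwise the three pairs of trees meet in points \<open>x\<^sub>1, x\<^sub>2, x\<^sub>3\<close>. Since \<open>i\<close> and \<open>i'\<close> are the medians
  of these points in the two balls and \<open>i \<noteq> i'\<close>, some \<open>x\<^sub>s, x\<^sub>t\<close> are joined by two different paths of
  length at most \<open>2d\<close>, one in each graph, the first one through \<open>i\<close>. The union of such a path with an ear
  has at most \<open>4d\<close> edges and one cycle, so the expected number of vertices \<open>i\<close> of this kind is at most
  \<open>lam ^ (4d)\<close> up to logarithms, which is \<open>o(n)\<close> because \<open>4 c ln lam < 1\<close>.
\<close>

section \<open>Paths, ears and explored trees\<close>

text \<open>The two edge indicators of one pair of vertices are correlated, whereas each of them
  alone has mean \<open>lam / n\<close>. Every event estimated below is therefore arranged so that
  no pair of vertices is constrained in both graphs: an ear shares no edge with the path it hangs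
  on, and the two trees of an estimated message are vertex-disjoint. Probabilities then come from
  cylinder events of product form, and finite sums over labelled trees take the place of a coupling
  with a branching process. Such a tree sum has mass close to 1 only if the trees are small against
  \<open>n\<close>, so balls are cut off at size \<open>n powr (3 / 4)\<close>. This exponent has to
  serve two ends. The first moment bound on ball sizes requires a cutoff well above
  \<open>n powr (1 / 2 + c * ln lam)\<close>. The error made in counting non-edges is of relative
  order cutoff over \<open>n\<close>; it grows by about \<open>lam\<close> per level, so the cutoff
  must stay well below \<open>n powr (1 - c * ln lam)\<close>. Both demands amount to
  \<open>c * ln lam < 1 / 4\<close>, the same condition under which configurations with one cycle
  are rare.\<close>

lemma ear_decomposition:
  assumes "distinct A" "distinct B" "A \<noteq> []" "B \<noteq> []" "hd A = hd B" "last A = last B" "A \<noteq> B"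
  shows "\<exists>A1 y A2 z A3 cs B2. A = A1 @ y # A2 @ z # A3 \<and> B = A1 @ y # cs @ z # B2 \<and>
    set cs \<inter> set A = {} \<and> (A2 \<noteq> [] \<or> cs \<noteq> [])"
  using assms
proof (induction A arbitrary: B)
  case Nil
  then show ?case by simp
next
  case (Cons x A')
  then obtain B' where B: "B = x # B'" by (cases B) auto
  have ne: "A' \<noteq> []" "B' \<noteq> []"
    using Cons.prems B by (auto simp: last_ConsR split: if_splits)
  then have last: "last A' = last B'" using Cons.prems B by simp
  show ?case
  proof (cases "hd A' = hd B'")
    case True
    obtain A1 y A2 z A3 cs B2 where *: "A' = A1 @ y # A2 @ z # A3" "B' = A1 @ y # cs @ z # B2"
      "set cs \<inter> set A' = {}" "A2 \<noteq> [] \<or> cs \<noteq> []"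
    proof -
      have "distinct A'" "distinct B'" "A' \<noteq> B'" using Cons.prems B by auto
      from Cons.IH[OF this(1,2) ne True last this(3)] show ?thesis using that by blast
    qed
    have "x # A' = (x # A1) @ y # A2 @ z # A3" "B = (x # A1) @ y # cs @ z # B2"
      "set cs \<inter> set (x # A') = {}"
      using * Cons.prems(2) B by auto
    with *(4) show ?thesis by blast
  next
    case False
    \<comment> \<open>The lists separate right after \<open>x\<close>. The ear ends at the first
      later vertex of \<open>B\<close> that returns to \<open>A\<close>; one exists because the last
      vertices agree.\<close>
    have "\<exists>b\<in>set B'. b \<in> set A'" using last ne by (metis last_in_set)
    then obtain cs z B2 where B': "B' = cs @ z # B2" "z \<in> set A'" "\<forall>c\<in>set cs. c \<notin> set A'"
      using split_list_first_prop[of B' "\<lambda>b. b \<in> set A'"] by auto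
    obtain A2 A3 where A': "A' = A2 @ z # A3" using B'(2) by (meson split_list)
    \<comment> \<open>If both were empty, \<open>A'\<close> and \<open>B'\<close> would both start
      with \<open>z\<close>, against the separation at \<open>x\<close>. This excludes an ear that
      is merely an edge of \<open>A\<close>.\<close>
    have "A2 \<noteq> [] \<or> cs \<noteq> []" using False A' B' by auto
    moreover have "x # A' = [] @ x # A2 @ z # A3" "B = [] @ x # cs @ z # B2"
      "set cs \<inter> set (x # A') = {}"
      using A' B' Cons.prems(2) B by auto
    ultimately show ?thesis by blast
  qed
qed

lemma is_cycleI:
  assumes "distinct l" "successively G l" "3 \<le> length l" "G (last l) (hd l)"
  shows "is_cycle G l"
  unfolding is_cycle_def
proof (intro conjI allI impI)
  fix k assume k: "k < length l"
  show "G (l ! k) (l ! (Suc k mod length l))"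
  proof (cases "Suc k = length l")
    case True
    then have "l \<noteq> []" "k = length l - 1" by auto
    then have "l ! k = last l" "l ! 0 = hd l" by (simp_all add: last_conv_nth hd_conv_nth)
    then show ?thesis using True assms(4) by simp
  next
    case False
    then show ?thesis using k assms(2) by (simp add: successively_conv_nth)
  qed
qed (use assms in auto)

lemma successively_infix: "successively P (a @ b @ c) \<Longrightarrow> successively P b"
  by (auto simp: successively_append_iff)

text \<open>The segment of \<open>A\<close> between the ends of the ear, followed by the ear
  backwards, is closed and has no repetition. It has at least three vertices because the segment and
  the ear are not both single edges.\<close>

lemma two_paths_cycle:
  assumes sym: "symp G"
    and "distinct A" "distinct B" "A \<noteq> []" "B \<noteq> []" "hd A = hd B" "last A = last B" "A \<noteq> B"
    and "successively G A" "successively G B"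
  shows "\<exists>l. set l \<subseteq> set A \<union> set B \<and> is_cycle G l"
proof -
  obtain A1 y A2 z A3 cs B2 where *: "A = A1 @ y # A2 @ z # A3" "B = A1 @ y # cs @ z # B2"
      "set cs \<inter> set A = {}" "A2 \<noteq> [] \<or> cs \<noteq> []"
    using ear_decomposition[OF assms(2-8)] by metis
  let ?l = "y # A2 @ z # rev cs"
  have A: "successively G (y # A2 @ [z])" and C: "successively G (y # cs @ [z])"
    using successively_infix[of G A1 "y # A2 @ [z]" A3] successively_infix[of G A1 "y # cs @ [z]" B2]
      assms(9,10) *(1,2) by auto
  have "successively G (rev (y # cs @ [z]))"
    using C sym by (subst successively_rev) (auto elim!: successively_mono simp: symp_def)
  then have C': "successively G (z # rev cs @ [y])" by simp
  have "is_cycle G ?l"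
  proof (rule is_cycleI)
    show "distinct ?l" using assms(2,3) * by auto
    have "successively G ((y # A2) @ [z])" "successively G ((z # rev cs) @ [y])" using A C' by auto
    then show "successively G ?l"
      by (subst append_Cons[symmetric], subst successively_append_iff)
        (auto simp only: successively_append_iff list.sel list.simps)
    show "3 \<le> length ?l" using *(4) by (cases A2; cases cs) auto
    have "successively G ((z # rev cs) @ [y])" using C' by auto
    then have "G (last (z # rev cs)) y" by (auto simp only: successively_append_iff list.sel list.simps)
    then show "G (last ?l) (hd ?l)" by simp
  qed
  moreover have "set ?l \<subseteq> set A \<union> set B" using * by auto
  ultimately show ?thesis by blast
qed

section \<open>Non-backtracking exploration of a cycle-free ball\<close>

datatype rtree = Leaf | Node "nat set" "nat \<Rightarrow> rtree"

text \<open>A node stores the labels of its children but not its own, so functions on trees take the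
  root label as an extra argument. Restricting the child function to the child set makes the
  explored tree an extensional object, which belongs to a finite set of possible outcomes.\<close>

primrec explore :: "graph \<Rightarrow> nat \<Rightarrow> nat \<Rightarrow> nat \<Rightarrow> rtree" where
  "explore G 0 x w = Leaf"
| "explore G (Suc k) x w = Node (nbrs G x - {w}) (\<lambda>y\<in>nbrs G x - {w}. explore G k y x)"

primrec verts :: "rtree \<Rightarrow> nat \<Rightarrow> nat set" where
  "verts Leaf = (\<lambda>x. {x})"
| "verts (Node S f) = (\<lambda>x. insert x (\<Union>y\<in>S. verts (f y) y))"

text \<open>All labels of the tree are distinct, so that the exploration is a genuine tree inside
  the graph. Only then do the numbers of edges and vertices add up over the subtrees.\<close>

primrec proper :: "rtree \<Rightarrow> nat \<Rightarrow> bool" where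
  "proper Leaf = (\<lambda>x. True)"
| "proper (Node S f) = (\<lambda>x. (\<forall>y\<in>S. x \<notin> verts (f y) y \<and> proper (f y) y) \<and>
     disjoint_family_on (\<lambda>y. verts (f y) y) S)"

lemma root_in_verts [simp]: "x \<in> verts t x"
  by (cases t) auto

lemma relpowp_successively:
  assumes "successively G l" "l \<noteq> []"
  shows "(G ^^ (length l - 1)) (hd l) (last l)"
  using assms
proof (induction l rule: rev_induct)
  case (snoc y l)
  show ?case
  proof (cases "l = []")
    case False
    then have "(G ^^ (length l - 1)) (hd l) (last l)" "G (last l) y"
      using snoc by (auto simp: successively_append_iff)
    then have "(G ^^ (Suc (length l - 1))) (hd l) y" by auto
    then show ?thesis using False by simp
  qed auto
qed simp

lemma path_in_ball:
  assumes "successively G l" "l \<noteq> []" "length l \<le> Suc d"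
  shows "set l \<subseteq> ball_graph G (hd l) d"
proof
  fix z assume "z \<in> set l"
  then obtain a b where l: "l = a @ z # b" by (meson split_list)
  have "(G ^^ (length (a @ [z]) - 1)) (hd (a @ [z])) (last (a @ [z]))"
    using assms(1) l by (intro relpowp_successively) (auto simp: successively_append_iff split: if_splits)
  moreover have "hd (a @ [z]) = hd l" using l by (cases a) auto
  ultimately show "z \<in> ball_graph G (hd l) d"
    using assms(3) l unfolding ball_graph_def by (auto intro!: exI[of _ "length a"])
qed

text \<open>If \<open>y\<close> were on \<open>r\<close>, the part of \<open>r\<close> from
  \<open>y\<close> to \<open>x\<close> would be closed by the edge \<open>x y\<close>. It has at
  least three vertices because \<open>y\<close> is neither \<open>x\<close> nor its predecessor
  \<open>w\<close>, and it stays in the ball because \<open>r\<close> starts at the centre.\<close>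

lemma ball_acyclic_no_chord:
  assumes "symp G" "ball_acyclic G i d" "successively G r" "distinct r" "r = r' @ [w, x]"
    "hd r = i" "length r \<le> Suc d" "G x y" "y \<noteq> w" "y \<noteq> x"
  shows "y \<notin> set r"
proof
  assume "y \<in> set r"
  then have "y \<in> set r'" using assms by auto
  then obtain a b where r: "r' = a @ y # b" by (meson split_list)
  have "is_cycle G (y # b @ [w, x])"
    using assms(3,4,8) unfolding assms(5) r
    by (intro is_cycleI) (auto simp: successively_append_iff split: if_splits)
  moreover have "set (y # b @ [w, x]) \<subseteq> ball_graph G i d"
    using path_in_ball[OF assms(3) _ assms(7)] assms(5,6) r by auto
  ultimately show False using assms(2) unfolding ball_acyclic_def by blast
qed

text \<open>The parent of the root is taken to be the root itself, which is not its own neighbour.\<close>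

definition ancestral :: "graph \<Rightarrow> nat \<Rightarrow> nat list \<Rightarrow> nat \<Rightarrow> nat \<Rightarrow> bool" where
  "ancestral G i r w x \<longleftrightarrow> successively G r \<and> distinct r \<and> r \<noteq> [] \<and> hd r = i \<and> last r = x \<and>
     (if r = [x] then w = x else \<exists>r'. r = r' @ [w, x])"

lemma ancestral_child:
  assumes "symp G" "irreflp G" "ball_acyclic G i d" "ancestral G i r w x" "length r \<le> Suc d"
    "y \<in> nbrs G x - {w}"
  shows "ancestral G i (r @ [y]) x y"
proof -
  have "G x y" "y \<noteq> w" "y \<noteq> x" using assms by (auto simp: nbrs_def irreflp_def)
  moreover have "y \<notin> set r"
  proof (cases "r = [x]")
    case False
    then obtain r' where "r = r' @ [w, x]" using assms(4) by (auto simp: ancestral_def)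
    then show ?thesis using assms calculation
      by (intro ball_acyclic_no_chord[of G i d r r' w x y]) (auto simp: ancestral_def)
  qed (use calculation in auto)
  ultimately show ?thesis using assms(4)
    unfolding ancestral_def by (auto simp: successively_append_iff) (metis append_butlast_last_id)
qed

text \<open>Acyclicity is known for the ball about \<open>i\<close>, not for one about
  \<open>x\<close>, so the path \<open>r\<close> from \<open>i\<close> down to \<open>x\<close> is
  carried through the induction. The budget \<open>length r + k \<le> Suc d\<close> keeps every
  branch inside that ball.\<close>

lemma explore_path:
  assumes "symp G" "irreflp G" "ball_acyclic G i d"
  shows "ancestral G i r w x \<Longrightarrow> length r + k \<le> Suc d \<Longrightarrow> z \<in> verts (explore G k x w) x \<Longrightarrow>
    \<exists>q. successively G (r @ q) \<and> distinct (r @ q) \<and> last (r @ q) = z \<and> length q \<le> k \<and>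
      set q \<subseteq> verts (explore G k x w) x"
proof (induction k arbitrary: r w x)
  case 0
  then show ?case by (intro exI[of _ "[]"]) (auto simp: ancestral_def)
next
  case (Suc k)
  show ?case
  proof (cases "z = x")
    case True
    then show ?thesis using Suc.prems by (intro exI[of _ "[]"]) (auto simp: ancestral_def)
  next
    case False
    then obtain y where y: "y \<in> nbrs G x - {w}" "z \<in> verts (explore G k y x) y"
      using Suc.prems(3) by auto
    have "ancestral G i (r @ [y]) x y" using Suc.prems y assms by (intro ancestral_child) auto
    from Suc.IH[OF this _ y(2)] obtain q where "successively G ((r @ [y]) @ q)"
      "distinct ((r @ [y]) @ q)" "last ((r @ [y]) @ q) = z" "length q \<le> k"
      "set q \<subseteq> verts (explore G k y x) y" using Suc.prems by auto
    moreover have "verts (explore G k y x) y \<subseteq> verts (explore G (Suc k) x w) x" "y \<in> verts (explore G k y x) y"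
      using y(1) by auto
    ultimately show ?thesis by (intro exI[of _ "y # q"]) (auto simp del: explore.simps)
  qed
qed

text \<open>A label occurring in two subtrees would be reached from \<open>i\<close> by two
  different paths within the ball, which contain a cycle.\<close>

lemma explore_proper:
  assumes "symp G" "irreflp G" "ball_acyclic G i d"
  shows "ancestral G i r w x \<Longrightarrow> length r + k \<le> Suc d \<Longrightarrow> proper (explore G k x w) x"
proof (induction k arbitrary: r w x)
  case (Suc k)
  have anc: "ancestral G i (r @ [y]) x y" if "y \<in> nbrs G x - {w}" for y
    using Suc.prems that assms by (intro ancestral_child) auto
  have path: "\<exists>q. successively G (r @ y # q) \<and> distinct (r @ y # q) \<and> last (r @ y # q) = z \<and>
      length q \<le> k" if "y \<in> nbrs G x - {w}" "z \<in> verts (explore G k y x) y" for y z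
    using explore_path[OF assms anc[OF that(1)] _ that(2)] Suc.prems by auto
  have xr: "x \<in> set r" "r \<noteq> []" "hd r = i" using Suc.prems(1) by (auto simp: ancestral_def)
  have "x \<notin> verts (explore G k y x) y" if y: "y \<in> nbrs G x - {w}" for y
  proof
    assume "x \<in> verts (explore G k y x) y"
    from path[OF y this] obtain q where q: "distinct (r @ y # q)" "last (r @ y # q) = x" by auto
    then have "x \<in> set (y # q)" by (metis append_is_Nil_conv last_appendR last_in_set list.distinct(1))
    then show False using q xr by auto
  qed
  moreover have "verts (explore G k y x) y \<inter> verts (explore G k y' x) y' = {}"
    if y: "y \<in> nbrs G x - {w}" "y' \<in> nbrs G x - {w}" "y \<noteq> y'" for y y'
  proof (rule ccontr)
    assume "\<not> ?thesis"
    then obtain z where z: "z \<in> verts (explore G k y x) y" "z \<in> verts (explore G k y' x) y'" by auto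
    obtain q where q: "successively G (r @ y # q)" "distinct (r @ y # q)" "last (r @ y # q) = z"
      "length q \<le> k" using path[OF y(1) z(1)] by auto
    obtain q' where q': "successively G (r @ y' # q')" "distinct (r @ y' # q')"
      "last (r @ y' # q') = z" "length q' \<le> k" using path[OF y(2) z(2)] by auto
    obtain l where "is_cycle G l" "set l \<subseteq> set (r @ y # q) \<union> set (r @ y' # q')"
      using two_paths_cycle[OF assms(1), of "r @ y # q" "r @ y' # q'"] q q' y(3) xr by auto
    moreover have "set (r @ y # q) \<subseteq> ball_graph G i d" "set (r @ y' # q') \<subseteq> ball_graph G i d"
      using path_in_ball[OF q(1), of d] path_in_ball[OF q'(1), of d] q q' xr Suc.prems(2) by auto
    ultimately show False using assms(3) unfolding ball_acyclic_def by blast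
  qed
  moreover have "proper (explore G k y x) y" if "y \<in> nbrs G x - {w}" for y
    using Suc.IH[OF anc[OF that]] Suc.prems by auto
  ultimately show ?case by (simp add: disjoint_family_on_def)
qed simp

lemma spider_legs:
  assumes "symp G" "irreflp G" "ball_acyclic G i (Suc k)"
    and "inj_on j T" "\<And>t. t \<in> T \<Longrightarrow> j t \<in> nbrs G i"
    and "\<And>t. t \<in> T \<Longrightarrow> x t \<in> verts (explore G k (j t) i) (j t)"
  obtains p where "\<And>t. t \<in> T \<Longrightarrow> successively G (i # p t) \<and> distinct (i # p t) \<and> p t \<noteq> [] \<and>
      last (p t) = x t \<and> length (p t) \<le> Suc k"
    and "\<And>t t'. t \<in> T \<Longrightarrow> t' \<in> T \<Longrightarrow> t \<noteq> t' \<Longrightarrow> set (p t) \<inter> set (p t') = {}"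
proof -
  have root: "ancestral G i [i] i i" by (simp add: ancestral_def)
  have anc: "ancestral G i [i, j t] i (j t)" if "t \<in> T" for t
    using ancestral_child[OF assms(1-3) root, of "j t"] assms(5)[OF that] assms(2)
    by (auto simp: nbrs_def irreflp_def)
  have "\<exists>q. successively G ([i, j t] @ q) \<and> distinct ([i, j t] @ q) \<and> last ([i, j t] @ q) = x t \<and>
      length q \<le> k \<and> set q \<subseteq> verts (explore G k (j t) i) (j t)" if "t \<in> T" for t
    using explore_path[OF assms(1-3) anc[OF that] _ assms(6)[OF that]] by auto
  then obtain q where q: "\<And>t. t \<in> T \<Longrightarrow> successively G ([i, j t] @ q t) \<and>
      distinct ([i, j t] @ q t) \<and> last ([i, j t] @ q t) = x t \<and>
      length (q t) \<le> k \<and> set (q t) \<subseteq> verts (explore G k (j t) i) (j t)"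
    by metis
  \<comment> \<open>The legs are disjoint because they lie in different subtrees of one tree rooted
    at \<open>i\<close>. Its parent argument \<open>i\<close> removes nothing, since
    \<open>i\<close> is not its own neighbour.\<close>
  have "proper (explore G (Suc k) i i) i"
    using explore_proper[OF assms(1-3) root, of "Suc k"] by simp
  then have disj: "verts (explore G k y i) y \<inter> verts (explore G k y' i) y' = {}"
    if "y \<in> nbrs G i" "y' \<in> nbrs G i" "y \<noteq> y'" for y y'
    using that assms(2) by (auto simp: disjoint_family_on_def nbrs_def irreflp_def)
  show ?thesis
  proof (rule that[of "\<lambda>t. j t # q t"])
    fix t t' assume t: "t \<in> T" "t' \<in> T" "t \<noteq> t'"
    then have "j t \<noteq> j t'" using assms(4) by (auto simp: inj_on_def)
    with disj[of "j t" "j t'"] t assms(5)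
    have "verts (explore G k (j t) i) (j t) \<inter> verts (explore G k (j t') i) (j t') = {}" by auto
    moreover have "set (j t # q t) \<subseteq> verts (explore G k (j t) i) (j t)" if "t \<in> T" for t
      using q[OF that] by auto
    ultimately show "set (j t # q t) \<inter> set (j t' # q t') = {}" using t by blast
  qed (use q in \<open>auto split: if_splits\<close>)
qed

text \<open>If each of the three legs at \<open>i\<close> met the corresponding leg at \<open>i'\<close>, then \<open>i\<close> and \<open>i'\<close> would
  both be the median of the three meeting points unless two of the meeting points are joined by
  two different paths.\<close>

lemma meeting_spiders:
  assumes "symp G" "irreflp G" "ball_acyclic G i (Suc k)"
    and "symp H" "irreflp H" "ball_acyclic H i' (Suc k)"
    and "i \<noteq> i'"
    and "inj_on j {1..3::nat}" "\<And>t. t \<in> {1..3} \<Longrightarrow> j t \<in> nbrs G i"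
    and "inj_on v {1..3::nat}" "\<And>t. t \<in> {1..3} \<Longrightarrow> v t \<in> nbrs H i'"
    and meet: "\<And>t. t \<in> {1..3} \<Longrightarrow>
      verts (explore G k (j t) i) (j t) \<inter> verts (explore H k (v t) i') (v t) \<noteq> {}"
  shows "\<exists>A B. distinct A \<and> distinct B \<and> A \<noteq> [] \<and> B \<noteq> [] \<and> hd A = hd B \<and> last A = last B \<and> A \<noteq> B \<and>
    successively G A \<and> successively H B \<and> i \<in> set A \<and>
    length A \<le> 2 * Suc k + 1 \<and> length B \<le> 2 * Suc k + 1"
proof -
  let ?T = "{1..3::nat}"
  have "\<exists>x. \<forall>t\<in>?T. x t \<in> verts (explore G k (j t) i) (j t) \<and> x t \<in> verts (explore H k (v t) i') (v t)"
    using meet by (intro bchoice ballI) blast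
  then obtain x where x: "\<And>t. t \<in> ?T \<Longrightarrow> x t \<in> verts (explore G k (j t) i) (j t)"
    "\<And>t. t \<in> ?T \<Longrightarrow> x t \<in> verts (explore H k (v t) i') (v t)" by blast
  obtain p where p: "\<And>t. t \<in> ?T \<Longrightarrow> successively G (i # p t) \<and> distinct (i # p t) \<and> p t \<noteq> [] \<and>
      last (p t) = x t \<and> length (p t) \<le> Suc k"
    and dp: "\<And>t t'. t \<in> ?T \<Longrightarrow> t' \<in> ?T \<Longrightarrow> t \<noteq> t' \<Longrightarrow> set (p t) \<inter> set (p t') = {}"
    using spider_legs[OF assms(1-3,8,9) x(1)] by blast
  obtain q where q: "\<And>t. t \<in> ?T \<Longrightarrow> successively H (i' # q t) \<and> distinct (i' # q t) \<and> q t \<noteq> [] \<and>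
      last (q t) = x t \<and> length (q t) \<le> Suc k"
    and dq: "\<And>t t'. t \<in> ?T \<Longrightarrow> t' \<in> ?T \<Longrightarrow> t \<noteq> t' \<Longrightarrow> set (q t) \<inter> set (q t') = {}"
    using spider_legs[OF assms(4-6,10,11) x(2)] by blast
  define A where "A = (\<lambda>t t'. rev (p t) @ i # p t')"
  define B where "B = (\<lambda>t t'. rev (q t) @ i' # q t')"
  have join: "successively R (rev a @ c # b)"
    if "symp R" "successively R (c # a)" "successively R (c # b)" for R :: graph and a b c
  proof -
    have "successively R (rev (c # a))"
      using that by (subst successively_rev) (auto elim!: successively_mono simp: symp_def)
    then show ?thesis using that(3) by (simp add: successively_append_iff)
  qed
  \<comment> \<open>If all three joining paths agreed in both graphs, \<open>i'\<close> would lie on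
    each of \<open>A 1 2\<close>, \<open>A 2 3\<close> and \<open>A 1 3\<close>. A vertex on one leg
    misses the path formed by the other two, so only \<open>i\<close> lies on all three.\<close>
  have neq: "\<exists>t\<in>?T. \<exists>t'\<in>?T. t \<noteq> t' \<and> A t t' \<noteq> B t t'"
  proof (rule ccontr)
    assume "\<not> ?thesis"
    then have eq: "t \<in> ?T \<Longrightarrow> t' \<in> ?T \<Longrightarrow> t \<noteq> t' \<Longrightarrow> A t t' = B t t'" for t t' by blast
    have "A 1 2 = B 1 2" "A 2 3 = B 2 3" "A 1 3 = B 1 3" by (intro eq; simp)+
    moreover have "i' \<in> set (B 1 2)" "i' \<in> set (B 2 3)" "i' \<in> set (B 1 3)" by (auto simp: B_def)
    ultimately have "i' \<in> set (A 1 2)" "i' \<in> set (A 2 3)" "i' \<in> set (A 1 3)" by auto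
    then show False using dp[of 1 2] dp[of 2 3] dp[of 1 3] assms(7) by (auto simp: A_def)
  qed
  then obtain t t' where t: "t \<in> ?T" "t' \<in> ?T" "t \<noteq> t'" "A t t' \<noteq> B t t'" by blast
  show ?thesis
  proof (rule exI[of _ "A t t'"], rule exI[of _ "B t t'"], intro conjI)
    show "distinct (A t t')" "distinct (B t t')"
      using p[OF t(1)] p[OF t(2)] dp[OF t(1-3)] q[OF t(1)] q[OF t(2)] dq[OF t(1-3)]
      by (auto simp: A_def B_def)
    show "successively G (A t t')" "successively H (B t t')"
      unfolding A_def B_def using p[OF t(1)] p[OF t(2)] q[OF t(1)] q[OF t(2)] assms(1,4)
      by (auto intro!: join simp del: successively.simps)
    show "hd (A t t') = hd (B t t')" "last (A t t') = last (B t t')"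
      unfolding A_def B_def using p[OF t(1)] p[OF t(2)] q[OF t(1)] q[OF t(2)]
      by (auto simp: hd_append hd_rev)
    show "length (A t t') \<le> 2 * Suc k + 1" "length (B t t') \<le> 2 * Suc k + 1"
      unfolding A_def B_def using p[OF t(1)] p[OF t(2)] q[OF t(1)] q[OF t(2)] by auto
  qed (use t in \<open>auto simp: A_def B_def\<close>)
qed

section \<open>Messages as functions of explored trees\<close>

text \<open>The message sees the graphs only through two explored trees, which turns its mean into a
  finite weighted sum. The value for a \<open>Node\<close> against a \<open>Leaf\<close> is a
  default: the trees compared always have equal depth.\<close>

primrec tree_msg :: "real \<Rightarrow> real \<Rightarrow> rtree \<Rightarrow> rtree \<Rightarrow> real" where
  "tree_msg lam s Leaf = (\<lambda>t'. 1)"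
| "tree_msg lam s (Node S f) = (\<lambda>t'. case t' of Leaf \<Rightarrow> 1 | Node S' f' \<Rightarrow>
     (\<Sum>m = 0..min (card S) (card S'). psi lam s m (card S) (card S') *
        (\<Sum>\<sigma> \<in> injections m S. \<Sum>\<sigma>' \<in> injections m S'.
           \<Prod>l = 1..m. tree_msg lam s (f (\<sigma> l)) (f' (\<sigma>' l)))))"

lemma msg_eq_tree_msg:
  assumes "symp G" "symp H" "\<And>x. finite (nbrs G x)" "\<And>x. finite (nbrs H x)"
  shows "j \<in> nbrs G i \<Longrightarrow> v \<in> nbrs H u \<Longrightarrow>
    msg lam s G H k i j u v = tree_msg lam s (explore G k i j) (explore H k u v)"
proof (induction k arbitrary: i j u v)
  case (Suc k)
  let ?S = "nbrs G i - {j}" and ?S' = "nbrs H u - {v}"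
  have c: "deg G i - 1 = card ?S" "deg H u - 1 = card ?S'"
    using Suc.prems assms(3,4) by (simp_all add: deg_def)
  moreover have "min (deg G i) (deg H u) - 1 = min (deg G i - 1) (deg H u - 1)" by simp
  ultimately have c': "min (deg G i) (deg H u) - 1 = min (card ?S) (card ?S')" by simp
  have "msg lam s G H k (\<sigma> l) i (\<sigma>' l) u =
      tree_msg lam s ((\<lambda>y\<in>?S. explore G k y i) (\<sigma> l)) ((\<lambda>y\<in>?S'. explore H k y u) (\<sigma>' l))"
    if "\<sigma> \<in> injections m ?S" "\<sigma>' \<in> injections m ?S'" "l \<in> {1..m}" for \<sigma> \<sigma>' m l
  proof -
    have "\<sigma> l \<in> ?S" "\<sigma>' l \<in> ?S'" using that by (auto simp: injections_def)
    moreover from this have "i \<in> nbrs G (\<sigma> l)" "u \<in> nbrs H (\<sigma>' l)"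
      using assms(1,2) by (auto simp: nbrs_def symp_def)
    ultimately show ?thesis using Suc.IH by simp
  qed
  then show ?case
    unfolding msg.simps c c' explore.simps tree_msg.simps rtree.case
    by (intro sum.cong prod.cong refl arg_cong2[where f = "(*)"])
qed simp

section \<open>Invariance under relabelling the second graph\<close>

lemma relpowp_relabel:
  assumes "bij f"
  shows "((\<lambda>u v. H (f u) (f v)) ^^ k) x y \<longleftrightarrow> (H ^^ k) (f x) (f y)"
proof (induction k arbitrary: y)
  case 0
  then show ?case using assms by (auto simp: bij_def inj_def)
next
  case (Suc k)
  have "(\<exists>w. (H ^^ k) (f x) (f w) \<and> H (f w) (f y)) \<longleftrightarrow> (\<exists>w. (H ^^ k) (f x) w \<and> H w (f y))"
    using assms by (metis bij_pointE)
  then show ?case using Suc by (auto simp: relcompp_apply)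
qed

lemma ball_acyclic_relabel:
  assumes f: "bij f" and "ball_acyclic (\<lambda>u v. H (f u) (f v)) x d"
  shows "ball_acyclic H (f x) d"
  unfolding ball_acyclic_def
proof
  assume "\<exists>xs. set xs \<subseteq> ball_graph H (f x) d \<and> is_cycle H xs"
  then obtain xs where xs: "set xs \<subseteq> ball_graph H (f x) d" "is_cycle H xs" by blast
  let ?g = "inv f" and ?H = "\<lambda>u v. H (f u) (f v)"
  have [simp]: "f (?g z) = z" for z using f by (simp add: bij_is_surj surj_f_inv_f)
  have inj: "inj ?g" using f by (simp add: bij_imp_bij_inv bij_is_inj)
  have "is_cycle ?H (map ?g xs)"
    unfolding is_cycle_def
  proof (intro conjI allI impI)
    fix k assume k: "k < length (map ?g xs)"
    then have "Suc k mod length xs < length xs" by (intro mod_less_divisor) auto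
    then show "?H (map ?g xs ! k) (map ?g xs ! (Suc k mod length (map ?g xs)))"
      using xs(2) k unfolding is_cycle_def by simp
  qed (use xs(2) inj in \<open>auto simp: is_cycle_def distinct_map inj_on_def inj_def\<close>)
  moreover have "set (map ?g xs) \<subseteq> ball_graph ?H x d"
    using xs(1) by (auto simp: ball_graph_def relpowp_relabel[OF f])
  ultimately show False using assms(2) unfolding ball_acyclic_def by blast
qed

lemma nbrs_relabel:
  assumes "bij f" shows "f ` (nbrs (\<lambda>u v. H (f u) (f v)) u - {v}) = nbrs H (f u) - {f v}"
proof -
  have "z \<in> f ` (nbrs (\<lambda>u v. H (f u) (f v)) u - {v})" if "z \<in> nbrs H (f u) - {f v}" for z
  proof -
    obtain w where "z = f w" using assms by (metis bij_pointE)
    then show ?thesis using that by (auto simp: nbrs_def)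
  qed
  then show ?thesis using assms by (auto simp: nbrs_def bij_def inj_def)
qed

lemma bij_betw_injections:
  assumes "inj_on f B"
  shows "bij_betw (\<lambda>\<sigma>. \<lambda>l\<in>{1..m}. f (\<sigma> l)) (injections m B) (injections m (f ` B))"
proof (rule bij_betw_byWitness[where f' = "\<lambda>\<sigma>. \<lambda>l\<in>{1..m}. inv_into B f (\<sigma> l)"])
  show "\<forall>a\<in>injections m B. (\<lambda>l\<in>{1..m}. inv_into B f ((\<lambda>l\<in>{1..m}. f (a l)) l)) = a"
  proof
    fix a assume "a \<in> injections m B"
    then have "a \<in> {1..m} \<rightarrow>\<^sub>E B" by (simp add: injections_def)
    then show "(\<lambda>l\<in>{1..m}. inv_into B f ((\<lambda>l\<in>{1..m}. f (a l)) l)) = a"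
      using assms by (intro extensionalityI[of _ "{1..m}"]) (auto simp: PiE_def Pi_def)
  qed
  show "\<forall>a\<in>injections m (f ` B). (\<lambda>l\<in>{1..m}. f ((\<lambda>l\<in>{1..m}. inv_into B f (a l)) l)) = a"
  proof
    fix a assume "a \<in> injections m (f ` B)"
    then have a: "a \<in> {1..m} \<rightarrow>\<^sub>E f ` B" by (simp add: injections_def)
    then have "f (inv_into B f (a l)) = a l" if "l \<in> {1..m}" for l
      using that by (intro f_inv_into_f) auto
    then show "(\<lambda>l\<in>{1..m}. f ((\<lambda>l\<in>{1..m}. inv_into B f (a l)) l)) = a"
      using a by (intro extensionalityI[of _ "{1..m}"]) (auto simp: PiE_def)
  qed
  show "(\<lambda>\<sigma>. \<lambda>l\<in>{1..m}. f (\<sigma> l)) ` injections m B \<subseteq> injections m (f ` B)"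
  proof
    fix \<tau> assume "\<tau> \<in> (\<lambda>\<sigma>. \<lambda>l\<in>{1..m}. f (\<sigma> l)) ` injections m B"
    then obtain \<sigma> where \<sigma>: "\<tau> = (\<lambda>l\<in>{1..m}. f (\<sigma> l))" "\<sigma> \<in> {1..m} \<rightarrow>\<^sub>E B" "inj_on \<sigma> {1..m}"
      unfolding injections_def by blast
    have "inj_on \<tau> {1..m}"
    proof (rule inj_onI)
      fix a b assume ab: "a \<in> {1..m}" "b \<in> {1..m}" "\<tau> a = \<tau> b"
      have "\<sigma> a \<in> B" "\<sigma> b \<in> B" using \<sigma>(2) ab by auto
      moreover have "f (\<sigma> a) = f (\<sigma> b)" using ab \<sigma>(1) by simp
      ultimately have "\<sigma> a = \<sigma> b" using inj_onD[OF assms] by blast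
      then show "a = b" using inj_onD[OF \<sigma>(3)] ab by blast
    qed
    moreover have "\<tau> \<in> {1..m} \<rightarrow>\<^sub>E f ` B" unfolding \<sigma>(1) using \<sigma>(2) by auto
    ultimately show "\<tau> \<in> injections m (f ` B)" by (simp add: injections_def)
  qed
  show "(\<lambda>\<sigma>. \<lambda>l\<in>{1..m}. inv_into B f (\<sigma> l)) ` injections m (f ` B) \<subseteq> injections m B"
  proof
    fix \<tau> assume "\<tau> \<in> (\<lambda>\<sigma>. \<lambda>l\<in>{1..m}. inv_into B f (\<sigma> l)) ` injections m (f ` B)"
    then obtain \<sigma> where \<sigma>: "\<tau> = (\<lambda>l\<in>{1..m}. inv_into B f (\<sigma> l))" "\<sigma> \<in> {1..m} \<rightarrow>\<^sub>E f ` B"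
      "inj_on \<sigma> {1..m}" unfolding injections_def by blast
    have im: "\<sigma> l \<in> f ` B" if "l \<in> {1..m}" for l using \<sigma>(2) that by (rule PiE_mem)
    have "inj_on \<tau> {1..m}"
    proof (rule inj_onI)
      fix a b assume ab: "a \<in> {1..m}" "b \<in> {1..m}" "\<tau> a = \<tau> b"
      then have "inv_into B f (\<sigma> a) = inv_into B f (\<sigma> b)" using \<sigma>(1) by simp
      then have "\<sigma> a = \<sigma> b" using im ab by (meson inv_into_injective)
      then show "a = b" using inj_onD[OF \<sigma>(3)] ab by blast
    qed
    moreover have "\<tau> \<in> {1..m} \<rightarrow>\<^sub>E B" unfolding \<sigma>(1) using im by (auto intro: inv_into_into)
    ultimately show "\<tau> \<in> injections m B" by (simp add: injections_def)
  qed
qed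

text \<open>Composition with \<open>f\<close> is a bijection between the injections into a
  neighbourhood and those into its image, and degrees are preserved; the inner sums therefore match
  term by term at every level.\<close>

lemma msg_relabel:
  assumes f: "bij f"
  shows "msg lam s G (\<lambda>u v. H (f u) (f v)) k i j u v = msg lam s G H k i j (f u) (f v)"
proof (induction k arbitrary: i j u v)
  case (Suc k)
  let ?H = "\<lambda>u v. H (f u) (f v)"
  have "nbrs H (f u) = f ` nbrs ?H u"
  proof -
    have "z \<in> f ` nbrs ?H u" if "z \<in> nbrs H (f u)" for z
    proof -
      obtain w where "z = f w" using f by (metis bij_pointE)
      then show ?thesis using that by (auto simp: nbrs_def)
    qed
    then show ?thesis by (auto simp: nbrs_def)
  qed
  then have deg: "deg H (f u) = deg ?H u"
    using f by (simp add: deg_def card_image bij_def inj_on_subset[OF _ subset_UNIV])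
  have inj: "inj_on f (nbrs ?H u - {v})" using f by (auto simp: bij_def inj_on_def)
  have "(\<Sum>\<sigma>' \<in> injections m (nbrs ?H u - {v}). \<Prod>l = 1..m. msg lam s G H k (\<sigma> l) i (f (\<sigma>' l)) (f u)) =
     (\<Sum>\<sigma>' \<in> injections m (nbrs H (f u) - {f v}). \<Prod>l = 1..m. msg lam s G H k (\<sigma> l) i (\<sigma>' l) (f u))"
    for m \<sigma>
    unfolding sum.reindex_bij_betw[OF bij_betw_injections[OF inj, of m], unfolded nbrs_relabel[OF f], symmetric]
    by (intro sum.cong prod.cong refl) auto
  then show ?case using Suc by (simp add: deg)
qed simp

section \<open>The mean of the message over weighted trees\<close>

primrec trees :: "nat set \<Rightarrow> nat \<Rightarrow> rtree set" where
  "trees V 0 = {Leaf}"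
| "trees V (Suc k) = (\<Union>S\<in>Pow V. Node S ` (S \<rightarrow>\<^sub>E trees V k))"

lemma finite_trees: "finite V \<Longrightarrow> finite (trees V k)"
  by (induction k) (auto intro!: finite_PiE intro: finite_subset)

lemma explore_in_trees: "(\<And>x. nbrs G x \<subseteq> V) \<Longrightarrow> explore G k x w \<in> trees V k"
proof (induction k arbitrary: x w)
  case (Suc k)
  then have "nbrs G x - {w} \<in> Pow V" by auto
  then show ?case using Suc by (auto intro!: bexI[of _ "nbrs G x - {w}"])
qed simp

text \<open>Here \<open>p\<close> is the probability of an edge, and \<open>q\<close> bounds the probability that a vertex has no
  neighbours apart from the prescribed ones.\<close>

primrec tree_weight :: "real \<Rightarrow> real \<Rightarrow> rtree \<Rightarrow> real" where
  "tree_weight q p Leaf = 1"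
| "tree_weight q p (Node S f) = q * p ^ card S * (\<Prod>y\<in>S. tree_weight q p (f y))"

lemma tree_weight_nonneg: "0 \<le> q \<Longrightarrow> 0 \<le> p \<Longrightarrow> 0 \<le> tree_weight q p t"
  by (induction t) (auto intro!: mult_nonneg_nonneg prod_nonneg)

lemma psi_nonneg: "lam > 0 \<Longrightarrow> 0 \<le> s \<Longrightarrow> s \<le> 1 \<Longrightarrow> 0 \<le> psi lam s m a b"
  by (auto simp: psi_def)

lemma tree_msg_nonneg: "lam > 0 \<Longrightarrow> 0 \<le> s \<Longrightarrow> s \<le> 1 \<Longrightarrow> 0 \<le> tree_msg lam s t t'"
proof (induction t arbitrary: t')
  case (Node S f)
  then show ?case
    by (cases t') (auto intro!: sum_nonneg prod_nonneg mult_nonneg_nonneg psi_nonneg)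
qed simp

lemma sum_trees_Suc:
  fixes g :: "rtree \<Rightarrow> real"
  assumes "finite V"
  shows "(\<Sum>t\<in>trees V (Suc k). g t) = (\<Sum>S\<in>Pow V. \<Sum>f\<in>S \<rightarrow>\<^sub>E trees V k. g (Node S f))"
proof -
  have "(\<Sum>t\<in>trees V (Suc k). g t) = (\<Sum>S\<in>Pow V. \<Sum>t\<in>Node S ` (S \<rightarrow>\<^sub>E trees V k). g t)"
    unfolding trees.simps using assms finite_trees[OF assms]
    by (intro sum.UNION_disjoint) (auto intro!: finite_PiE intro: finite_subset)
  also have "\<dots> = (\<Sum>S\<in>Pow V. \<Sum>f\<in>S \<rightarrow>\<^sub>E trees V k. g (Node S f))"
    by (intro sum.cong refl) (simp add: sum.reindex inj_on_def)
  finally show ?thesis .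
qed

text \<open>The summand is a product over the children, so the sum over all assignments of subtrees
  factorises: a child hit by \<open>\<sigma>\<close> contributes its weighted kernel sum, each of
  the other \<open>card S - m\<close> children the total weight.\<close>

lemma sum_PiE_injection:
  fixes w :: "'a \<Rightarrow> real" and g :: "nat \<Rightarrow> 'a \<Rightarrow> real"
  assumes "finite S" "finite T" and \<sigma>: "\<sigma> \<in> injections m S"
  shows "(\<Sum>f\<in>S \<rightarrow>\<^sub>E T. (\<Prod>y\<in>S. w (f y)) * (\<Prod>l = 1..m. g l (f (\<sigma> l)))) =
    (\<Prod>l = 1..m. \<Sum>t\<in>T. w t * g l t) * (\<Sum>t\<in>T. w t) ^ (card S - m)"
proof -
  let ?I = "\<sigma> ` {1..m}"
  have inj: "inj_on \<sigma> {1..m}" and sub: "?I \<subseteq> S" using \<sigma> by (auto simp: injections_def)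
  \<comment> \<open>\<open>h\<close> carries the factor with index \<open>l\<close> over to the
    child \<open>\<sigma> l\<close> and is 1 at unmatched children, so that both products run over
    \<open>S\<close>.\<close>
  define h where "h = (\<lambda>y. if y \<in> ?I then g (the_inv_into {1..m} \<sigma> y) else (\<lambda>_. 1))"
  have h: "h (\<sigma> l) = g l" if "l \<in> {1..m}" for l
    using that inj by (simp add: h_def the_inv_into_f_f)
  have split: "(\<Prod>y\<in>S. A y) = (\<Prod>l = 1..m. A (\<sigma> l)) * (\<Prod>y\<in>S - ?I. A y)" for A :: "nat \<Rightarrow> real"
    using prod.subset_diff[OF sub assms(1), of A] prod.reindex[OF inj, of A]
    by (simp add: mult.commute)
  have "(\<Prod>y\<in>S. h y (f y)) = (\<Prod>l = 1..m. g l (f (\<sigma> l)))" for f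
    unfolding split[of "\<lambda>y. h y (f y)"] using h by (auto simp: h_def intro!: prod.cong)
  then have "(\<Sum>f\<in>S \<rightarrow>\<^sub>E T. (\<Prod>y\<in>S. w (f y)) * (\<Prod>l = 1..m. g l (f (\<sigma> l)))) =
      (\<Sum>f\<in>S \<rightarrow>\<^sub>E T. \<Prod>y\<in>S. w (f y) * h y (f y))"
    by (simp add: prod.distrib)
  also have "\<dots> = (\<Prod>y\<in>S. \<Sum>t\<in>T. w t * h y t)"
    using assms by (subst prod_sum_PiE) auto
  also have "\<dots> = (\<Prod>l = 1..m. \<Sum>t\<in>T. w t * g l t) * (\<Prod>y\<in>S - ?I. \<Sum>t\<in>T. w t)"
    unfolding split[of "\<lambda>y. \<Sum>t\<in>T. w t * h y t"] using h
    by (intro arg_cong2[where f = "(*)"] prod.cong refl) (auto simp: h_def)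
  also have "card (S - ?I) = card S - m"
    using sub assms(1) inj by (subst card_Diff_subset) (auto simp: card_image intro: finite_subset)
  then have "(\<Prod>y\<in>S - ?I. \<Sum>t\<in>T. w t) = (\<Sum>t\<in>T. w t) ^ (card S - m)" by simp
  finally show ?thesis .
qed

lemma sum_Pow_power:
  fixes x :: real
  assumes "finite U" shows "(\<Sum>S\<in>Pow U. x ^ card S) = (1 + x) ^ card U"
  using prod_add[OF assms, of "\<lambda>_. x" "\<lambda>_. 1"] by (simp add: add.commute)

lemma sum_supersets_power:
  fixes p z :: real
  assumes "finite V" "R \<subseteq> V"
  shows "(\<Sum>S\<in>{S\<in>Pow V. R \<subseteq> S}. p ^ card S * z ^ (card S - card R)) =
    p ^ card R * (1 + p * z) ^ (card V - card R)"
proof -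
  have fR: "finite R" using assms finite_subset by blast
  have eq: "{S\<in>Pow V. R \<subseteq> S} = (\<union>) R ` Pow (V - R)"
  proof
    show "{S\<in>Pow V. R \<subseteq> S} \<subseteq> (\<union>) R ` Pow (V - R)"
    proof
      fix S assume "S \<in> {S\<in>Pow V. R \<subseteq> S}"
      then have "S = R \<union> (S - R)" "S - R \<in> Pow (V - R)" by auto
      then show "S \<in> (\<union>) R ` Pow (V - R)" by blast
    qed
  qed (use assms in auto)
  have inj: "inj_on ((\<union>) R) (Pow (V - R))" by (intro inj_onI) blast
  have "(\<Sum>S\<in>{S\<in>Pow V. R \<subseteq> S}. p ^ card S * z ^ (card S - card R)) =
      (\<Sum>S\<in>Pow (V - R). p ^ card (R \<union> S) * z ^ (card (R \<union> S) - card R))"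
    unfolding eq by (simp add: sum.reindex[OF inj])
  also have "\<dots> = (\<Sum>S\<in>Pow (V - R). p ^ card R * (p * z) ^ card S)"
  proof (intro sum.cong refl)
    fix S assume "S \<in> Pow (V - R)"
    then have "card (R \<union> S) = card R + card S"
      using assms(1) fR by (intro card_Un_disjoint) (auto intro: finite_subset)
    then show "p ^ card (R \<union> S) * z ^ (card (R \<union> S) - card R) = p ^ card R * (p * z) ^ card S"
      by (simp add: power_add power_mult_distrib)
  qed
  also have "\<dots> = p ^ card R * (1 + p * z) ^ card (V - R)"
    using assms(1) by (simp add: sum_Pow_power sum_distrib_left[symmetric])
  also have "card (V - R) = card V - card R" using fR assms by (simp add: card_Diff_subset)
  finally show ?thesis .
qed

lemma one_plus_power_le_exp: "0 \<le> (x::real) \<Longrightarrow> (1 + x) ^ n \<le> exp (real n * x)"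
  using exp_ge_add_one_self[of x] by (auto simp: exp_of_nat_mult intro!: power_mono)

lemma finite_injections: "finite S \<Longrightarrow> finite (injections m S)"
  unfolding injections_def by (rule finite_subset[of _ "{1..m} \<rightarrow>\<^sub>E S"]) (auto intro!: finite_PiE)

text \<open>Exchange the order: fix an injection into \<open>V\<close> and sum over the child sets
  containing its image. This leaves \<open>p ^ m\<close> for the matched children and a binomial sum
  for the rest, and there are at most \<open>card V ^ m\<close> injections. It is the finite
  counterpart of a factorial moment of a Poisson number of children.\<close>

lemma sum_injections_power_le:
  fixes p z :: real
  assumes "finite V" "0 \<le> p" "0 \<le> z"
  shows "(\<Sum>S\<in>Pow V. real (card (injections m S)) * (p ^ card S * z ^ (card S - m))) \<le>
    (real (card V) * p) ^ m * exp (real (card V) * p * z)"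
proof -
  have inj_eq: "injections m S = {\<sigma> \<in> injections m V. \<sigma> ` {1..m} \<subseteq> S}" if "S \<subseteq> V" for S
    using that unfolding injections_def by (auto simp: PiE_def)
  have "(\<Sum>S\<in>Pow V. real (card (injections m S)) * (p ^ card S * z ^ (card S - m))) =
      (\<Sum>S\<in>Pow V. \<Sum>\<sigma>\<in>{\<sigma> \<in> injections m V. \<sigma> ` {1..m} \<subseteq> S}. p ^ card S * z ^ (card S - m))"
  proof (intro sum.cong refl)
    fix S assume "S \<in> Pow V"
    then have "injections m S = {\<sigma> \<in> injections m V. \<sigma> ` {1..m} \<subseteq> S}" by (intro inj_eq) auto
    then show "real (card (injections m S)) * (p ^ card S * z ^ (card S - m)) =
        (\<Sum>\<sigma>\<in>{\<sigma> \<in> injections m V. \<sigma> ` {1..m} \<subseteq> S}. p ^ card S * z ^ (card S - m))"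
      by (simp only: sum_constant)
  qed
  also have "\<dots> = (\<Sum>\<sigma>\<in>injections m V. \<Sum>S\<in>{S\<in>Pow V. \<sigma> ` {1..m} \<subseteq> S}. p ^ card S * z ^ (card S - m))"
    using assms by (intro sum.swap_restrict finite_injections) auto
  also have "\<dots> \<le> (\<Sum>\<sigma>\<in>injections m V. p ^ m * exp (real (card V) * p * z))"
  proof (rule sum_mono)
    fix \<sigma> assume "\<sigma> \<in> injections m V"
    then have R: "\<sigma> ` {1..m} \<subseteq> V" "card (\<sigma> ` {1..m}) = m"
      by (auto simp: injections_def card_image)
    have "(\<Sum>S\<in>{S\<in>Pow V. \<sigma> ` {1..m} \<subseteq> S}. p ^ card S * z ^ (card S - m)) =
        p ^ m * (1 + p * z) ^ (card V - m)"
      using sum_supersets_power[OF assms(1) R(1), of p z] R(2) by simp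
    also have "\<dots> \<le> p ^ m * (1 + p * z) ^ card V"
      using assms by (intro mult_left_mono power_increasing) auto
    also have "\<dots> \<le> p ^ m * exp (real (card V) * (p * z))"
      using assms by (intro mult_left_mono one_plus_power_le_exp) auto
    finally show "(\<Sum>S\<in>{S\<in>Pow V. \<sigma> ` {1..m} \<subseteq> S}. p ^ card S * z ^ (card S - m)) \<le>
      p ^ m * exp (real (card V) * p * z)" by (simp add: mult.assoc)
  qed
  also have "\<dots> = real (card (injections m V)) * (p ^ m * exp (real (card V) * p * z))" by simp
  also have "card (injections m V) \<le> card ({1..m} \<rightarrow>\<^sub>E V)"
    using assms(1) unfolding injections_def by (intro card_mono finite_PiE) auto
  then have "real (card (injections m V)) \<le> real (card V) ^ m"
    by (simp add: card_PiE flip: of_nat_power)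
  then have "real (card (injections m V)) * (p ^ m * exp (real (card V) * p * z)) \<le>
      real (card V) ^ m * (p ^ m * exp (real (card V) * p * z))"
    using assms by (intro mult_right_mono) auto
  finally show ?thesis by (simp add: power_mult_distrib mult.assoc)
qed

section \<open>Recursions for the total mass and the mean message\<close>

definition weight_sum :: "nat set \<Rightarrow> real \<Rightarrow> real \<Rightarrow> nat \<Rightarrow> real" where
  "weight_sum V q p k = (\<Sum>t\<in>trees V k. tree_weight q p t)"

text \<open>This would be the mean of the message between two independent trees if the weights were
  probabilities. They only dominate probabilities, so \<open>weight_sum\<close> may exceed 1 and has
  to be controlled as well.\<close>

definition msg_sum :: "nat set \<Rightarrow> real \<Rightarrow> real \<Rightarrow> real \<Rightarrow> real \<Rightarrow> nat \<Rightarrow> real" where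
  "msg_sum V q p lam s k = (\<Sum>t\<in>trees V k. \<Sum>t'\<in>trees V k. tree_weight q p t * tree_weight q p t' * tree_msg lam s t t')"

lemma weight_sum_nonneg: "0 \<le> q \<Longrightarrow> 0 \<le> p \<Longrightarrow> 0 \<le> weight_sum V q p k"
  unfolding weight_sum_def by (intro sum_nonneg tree_weight_nonneg) auto

lemma msg_sum_nonneg: "0 \<le> q \<Longrightarrow> 0 \<le> p \<Longrightarrow> lam > 0 \<Longrightarrow> 0 \<le> s \<Longrightarrow> s \<le> 1 \<Longrightarrow> 0 \<le> msg_sum V q p lam s k"
  unfolding msg_sum_def by (intro sum_nonneg mult_nonneg_nonneg tree_weight_nonneg tree_msg_nonneg) auto

lemma weight_sum_Suc_le:
  assumes "finite V" "0 \<le> q" "0 \<le> p"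
  shows "weight_sum V q p (Suc k) \<le> q * exp (real (card V) * p * weight_sum V q p k)"
proof -
  have "weight_sum V q p (Suc k) = (\<Sum>S\<in>Pow V. \<Sum>f\<in>S \<rightarrow>\<^sub>E trees V k. q * p ^ card S * (\<Prod>y\<in>S. tree_weight q p (f y)))"
    unfolding weight_sum_def by (simp add: sum_trees_Suc[OF assms(1)] del: trees.simps)
  also have "\<dots> = (\<Sum>S\<in>Pow V. q * (p * weight_sum V q p k) ^ card S)"
  proof (intro sum.cong refl)
    fix S assume "S \<in> Pow V"
    then have "finite S" using assms(1) finite_subset by auto
    then have "(\<Sum>f\<in>S \<rightarrow>\<^sub>E trees V k. \<Prod>y\<in>S. tree_weight q p (f y)) = (\<Prod>y\<in>S. \<Sum>t\<in>trees V k. tree_weight q p t)"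
      using finite_trees[OF assms(1)] by (subst prod_sum_PiE) auto
    then show "(\<Sum>f\<in>S \<rightarrow>\<^sub>E trees V k. q * p ^ card S * (\<Prod>y\<in>S. tree_weight q p (f y))) =
        q * (p * weight_sum V q p k) ^ card S"
      by (simp add: weight_sum_def power_mult_distrib sum_distrib_left[symmetric])
  qed
  also have "\<dots> = q * (1 + p * weight_sum V q p k) ^ card V"
    using assms(1) by (simp add: sum_Pow_power sum_distrib_left[symmetric])
  also have "\<dots> \<le> q * exp (real (card V) * (p * weight_sum V q p k))"
    using assms by (intro mult_left_mono one_plus_power_le_exp mult_nonneg_nonneg weight_sum_nonneg) auto
  finally show ?thesis by (simp add: mult.assoc)
qed

lemma sum_power_div_fact_le_exp:
  fixes x :: real assumes "0 \<le> x" shows "(\<Sum>m\<le>n. x ^ m / fact m) \<le> exp x"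
proof -
  have "(\<Sum>m\<le>n. x ^ m / fact m) = (\<Sum>m<Suc n. x ^ m /\<^sub>R fact m)"
    by (simp add: lessThan_Suc_atMost divide_inverse mult.commute)
  also have "\<dots> \<le> (\<Sum>m. x ^ m /\<^sub>R fact m)"
    using assms by (intro sum_le_suminf summable_exp_generic) auto
  finally show ?thesis by (simp add: exp_def)
qed

lemma sum_pairs_PiE_injections:
  assumes "finite S" "finite S'" "finite T" "\<sigma> \<in> injections m S" "\<sigma>' \<in> injections m S'"
  shows "(\<Sum>f\<in>S \<rightarrow>\<^sub>E T. \<Sum>f'\<in>S' \<rightarrow>\<^sub>E T. (\<Prod>y\<in>S. w (f y)) * (\<Prod>y\<in>S'. w (f' y)) *
      (\<Prod>l = 1..m. K (f (\<sigma> l)) (f' (\<sigma>' l)))) =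
    (\<Sum>t\<in>T. \<Sum>t'\<in>T. w t * w t' * (K t t' :: real)) ^ m * (\<Sum>t\<in>T. w t) ^ (card S - m) *
      (\<Sum>t\<in>T. w t) ^ (card S' - m)"
proof -
  let ?W = "\<Sum>t\<in>T. w t"
  have "(\<Sum>f\<in>S \<rightarrow>\<^sub>E T. \<Sum>f'\<in>S' \<rightarrow>\<^sub>E T. (\<Prod>y\<in>S. w (f y)) * (\<Prod>y\<in>S'. w (f' y)) *
      (\<Prod>l = 1..m. K (f (\<sigma> l)) (f' (\<sigma>' l)))) =
    (\<Sum>f\<in>S \<rightarrow>\<^sub>E T. (\<Prod>y\<in>S. w (f y)) * (\<Sum>f'\<in>S' \<rightarrow>\<^sub>E T. (\<Prod>y\<in>S'. w (f' y)) *
      (\<Prod>l = 1..m. K (f (\<sigma> l)) (f' (\<sigma>' l)))))"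
    by (simp add: sum_distrib_left mult.assoc)
  also have "\<dots> = (\<Sum>f\<in>S \<rightarrow>\<^sub>E T. (\<Prod>y\<in>S. w (f y)) *
      ((\<Prod>l = 1..m. \<Sum>t'\<in>T. w t' * K (f (\<sigma> l)) t') * ?W ^ (card S' - m)))"
    by (subst sum_PiE_injection[OF assms(2,3,5)]) (rule refl)
  also have "\<dots> = (\<Sum>f\<in>S \<rightarrow>\<^sub>E T. (\<Prod>y\<in>S. w (f y)) *
      (\<Prod>l = 1..m. \<Sum>t'\<in>T. w t' * K (f (\<sigma> l)) t')) * ?W ^ (card S' - m)"
    by (simp add: sum_distrib_right mult.assoc)
  also have "\<dots> = (\<Prod>l = 1..m. \<Sum>t\<in>T. w t * (\<Sum>t'\<in>T. w t' * K t t')) * ?W ^ (card S - m) * ?W ^ (card S' - m)"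
    by (subst sum_PiE_injection[OF assms(1,3,4), where g = "\<lambda>_ t. \<Sum>t'\<in>T. w t' * K t t'"]) (rule refl)
  also have "(\<Sum>t\<in>T. w t * (\<Sum>t'\<in>T. w t' * K t t')) = (\<Sum>t\<in>T. \<Sum>t'\<in>T. w t * w t' * K t t')"
    by (simp add: sum_distrib_left mult.assoc)
  finally show ?thesis by simp
qed

lemma injections_empty: "finite S \<Longrightarrow> card S < m \<Longrightarrow> injections m S = {}"
  unfolding injections_def
  by (auto dest!: card_inj_on_le[rotated 2, of S])

text \<open>For a fixed number \<open>m\<close> of matched children the two root neighbourhoods
  decouple, each giving about \<open>lam ^ m\<close>. Against the factor
  \<open>s ^ m / (lam ^ m * fact m)\<close> in \<open>psi\<close> this leaves the exponential series
  in \<open>lam * s\<close> times the mean one level down.\<close>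

lemma msg_sum_Suc_le:
  assumes "finite V" "0 \<le> q" "0 \<le> p" "lam > 0" "0 \<le> s" "s \<le> 1" and lam: "real (card V) * p = lam"
  shows "msg_sum V q p lam s (Suc k) \<le>
    q\<^sup>2 * exp (lam * s + 2 * lam * (1 - s) * weight_sum V q p k + lam * s * msg_sum V q p lam s k)"
proof -
  let ?T = "trees V k" and ?W = "weight_sum V q p k" and ?F = "msg_sum V q p lam s k"
  let ?w = "tree_weight q p" and ?n = "card V"
  \<comment> \<open>The power of \<open>1 - s\<close> in \<open>psi\<close> assigns one factor to
    each unmatched child on either side. It is absorbed into the total weight of the subtree there,
    and \<open>c\<close> keeps what depends on \<open>m\<close> alone.\<close>
  define z where "z = (1 - s) * ?W"
  define c where "c = (\<lambda>m. exp (lam * s) * s ^ m / (lam ^ m * fact m))"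
  define a where "a = (\<lambda>m S. real (card (injections m S)) * (p ^ card S * z ^ (card S - m)))"
  have z0: "0 \<le> z" using assms weight_sum_nonneg by (simp add: z_def)
  have c0: "0 \<le> c m" for m using assms by (simp add: c_def)
  have fin: "finite S" if "S \<in> Pow V" for S using that assms(1) finite_subset by auto
  have inner: "(\<Sum>f\<in>S \<rightarrow>\<^sub>E ?T. \<Sum>f'\<in>S' \<rightarrow>\<^sub>E ?T. ?w (Node S f) * ?w (Node S' f') * tree_msg lam s (Node S f) (Node S' f')) =
      (\<Sum>m\<le>?n. q\<^sup>2 * c m * ?F ^ m * (a m S * a m S'))"
    if S: "S \<in> Pow V" "S' \<in> Pow V" for S S'
  proof -
    let ?M = "min (card S) (card S')"
    let ?P = "\<lambda>f f'. (\<Prod>y\<in>S. ?w (f y)) * (\<Prod>y\<in>S'. ?w (f' y))"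
    let ?L = "\<lambda>m \<sigma> \<sigma>' f f'. \<Prod>l = 1..m. tree_msg lam s (f (\<sigma> l)) (f' (\<sigma>' l))"
    let ?Q = "q\<^sup>2 * p ^ card S * p ^ card S'"
    have "(\<Sum>f\<in>S \<rightarrow>\<^sub>E ?T. \<Sum>f'\<in>S' \<rightarrow>\<^sub>E ?T. ?w (Node S f) * ?w (Node S' f') * tree_msg lam s (Node S f) (Node S' f')) =
      (\<Sum>f\<in>S \<rightarrow>\<^sub>E ?T. \<Sum>f'\<in>S' \<rightarrow>\<^sub>E ?T. \<Sum>m\<le>?M. \<Sum>\<sigma>\<in>injections m S. \<Sum>\<sigma>'\<in>injections m S'.
         ?Q * psi lam s m (card S) (card S') * (?P f f' * ?L m \<sigma> \<sigma>' f f'))"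
      by (intro sum.cong refl)
         (simp add: sum_distrib_left power2_eq_square mult_ac atMost_atLeast0)
    also have "\<dots> = (\<Sum>m\<le>?M. \<Sum>\<sigma>\<in>injections m S. \<Sum>\<sigma>'\<in>injections m S'.
        \<Sum>f\<in>S \<rightarrow>\<^sub>E ?T. \<Sum>f'\<in>S' \<rightarrow>\<^sub>E ?T. ?Q * psi lam s m (card S) (card S') * (?P f f' * ?L m \<sigma> \<sigma>' f f'))"
      apply (subst sum.swap[where B = "{..?M}"])
      apply (subst sum.swap[where B = "{..?M}"])
      apply (intro sum.cong refl)
      subgoal for m
        apply (subst sum.swap[where B = "injections m S"])
        apply (subst sum.swap[where B = "injections m S"])
        apply (intro sum.cong refl)
        apply (subst sum.swap[where B = "injections m S'"])
        apply (subst sum.swap[where B = "injections m S'"])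
        apply (intro sum.cong refl)
        done
      done
    also have "\<dots> = (\<Sum>m\<le>?M. \<Sum>\<sigma>\<in>injections m S. \<Sum>\<sigma>'\<in>injections m S'.
        ?Q * psi lam s m (card S) (card S') * (?F ^ m * ?W ^ (card S - m) * ?W ^ (card S' - m)))"
    proof (intro sum.cong refl)
      fix m \<sigma> \<sigma>' assume "\<sigma> \<in> injections m S" "\<sigma>' \<in> injections m S'"
      from sum_pairs_PiE_injections[OF fin[OF S(1)] fin[OF S(2)] finite_trees[OF assms(1), of k] this,
          of ?w "tree_msg lam s"]
      show "(\<Sum>f\<in>S \<rightarrow>\<^sub>E ?T. \<Sum>f'\<in>S' \<rightarrow>\<^sub>E ?T. ?Q * psi lam s m (card S) (card S') * (?P f f' * ?L m \<sigma> \<sigma>' f f')) =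
        ?Q * psi lam s m (card S) (card S') * (?F ^ m * ?W ^ (card S - m) * ?W ^ (card S' - m))"
        unfolding msg_sum_def weight_sum_def by (simp only: sum_distrib_left[symmetric])
    qed
    also have "\<dots> = (\<Sum>m\<le>?M. q\<^sup>2 * c m * ?F ^ m * (a m S * a m S'))"
    proof (intro sum.cong refl)
      fix m assume "m \<in> {..?M}"
      then have "card S + card S' - 2 * m = (card S - m) + (card S' - m)" by auto
      then have "psi lam s m (card S) (card S') = c m * ((1 - s) ^ (card S - m) * (1 - s) ^ (card S' - m))"
        by (simp add: psi_def c_def power_add)
      then show "(\<Sum>\<sigma>\<in>injections m S. \<Sum>\<sigma>'\<in>injections m S'.
        ?Q * psi lam s m (card S) (card S') * (?F ^ m * ?W ^ (card S - m) * ?W ^ (card S' - m))) =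
        q\<^sup>2 * c m * ?F ^ m * (a m S * a m S')"
        by (simp add: a_def z_def power_mult_distrib mult_ac)
    qed
    \<comment> \<open>The range of \<open>m\<close> is made independent of \<open>S\<close> and
      \<open>S'\<close>, so that the sum over \<open>m\<close> can be moved outside. The added terms
      vanish because a set has no injection from a larger one.\<close>
    also have "\<dots> = (\<Sum>m\<le>?n. q\<^sup>2 * c m * ?F ^ m * (a m S * a m S'))"
    proof (rule sum.mono_neutral_left)
      show "{..?M} \<subseteq> {..?n}" using card_mono[of V S] S assms(1) by auto
      show "\<forall>m\<in>{..?n} - {..?M}. q\<^sup>2 * c m * ?F ^ m * (a m S * a m S') = 0"
      proof
        fix m assume "m \<in> {..?n} - {..?M}"
        then have "card S < m \<or> card S' < m" by auto
        then have "injections m S = {} \<or> injections m S' = {}"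
          using injections_empty fin S by blast
        then show "q\<^sup>2 * c m * ?F ^ m * (a m S * a m S') = 0" by (auto simp: a_def)
      qed
    qed simp
    finally show ?thesis .
  qed
  have "msg_sum V q p lam s (Suc k) = (\<Sum>S\<in>Pow V. \<Sum>S'\<in>Pow V. \<Sum>f\<in>S \<rightarrow>\<^sub>E ?T. \<Sum>f'\<in>S' \<rightarrow>\<^sub>E ?T.
      ?w (Node S f) * ?w (Node S' f') * tree_msg lam s (Node S f) (Node S' f'))"
    unfolding msg_sum_def sum_trees_Suc[OF assms(1)]
    by (intro sum.cong refl) (rule sum.swap)
  also have "\<dots> = (\<Sum>S\<in>Pow V. \<Sum>S'\<in>Pow V. \<Sum>m\<le>?n. q\<^sup>2 * c m * ?F ^ m * (a m S * a m S'))"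
    by (intro sum.cong refl inner)
  also have "\<dots> = (\<Sum>m\<le>?n. \<Sum>S\<in>Pow V. \<Sum>S'\<in>Pow V. q\<^sup>2 * c m * ?F ^ m * (a m S * a m S'))"
    apply (subst sum.swap[where B = "{..?n}"])
    apply (subst sum.swap[where B = "{..?n}"])
    apply (rule refl)
    done
  also have "\<dots> = (\<Sum>m\<le>?n. q\<^sup>2 * c m * ?F ^ m * (\<Sum>S\<in>Pow V. a m S)\<^sup>2)"
    unfolding power2_eq_square[of "sum _ _"] sum_product by (simp only: sum_distrib_left)
  also have "\<dots> \<le> (\<Sum>m\<le>?n. q\<^sup>2 * c m * ?F ^ m * (lam ^ m * exp (lam * z))\<^sup>2)"
  proof (intro sum_mono mult_left_mono power_mono)
    fix m
    show "(\<Sum>S\<in>Pow V. a m S) \<le> lam ^ m * exp (lam * z)"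
      using sum_injections_power_le[OF assms(1,3) z0, of m] unfolding a_def lam .
    show "0 \<le> (\<Sum>S\<in>Pow V. a m S)" using assms z0 by (auto simp: a_def intro!: sum_nonneg)
    show "0 \<le> q\<^sup>2 * c m * ?F ^ m" using assms c0 msg_sum_nonneg by simp
  qed
  also have "\<dots> = (\<Sum>m\<le>?n. q\<^sup>2 * exp (lam * s + 2 * (lam * z)) * ((lam * s * ?F) ^ m / fact m))"
  proof (intro sum.cong refl)
    fix m
    have "exp (lam * s + 2 * (lam * z)) = exp (lam * s) * exp (lam * z) * exp (lam * z)"
      by (simp add: exp_add exp_double power2_eq_square)
    then show "q\<^sup>2 * c m * ?F ^ m * (lam ^ m * exp (lam * z))\<^sup>2 =
        q\<^sup>2 * exp (lam * s + 2 * (lam * z)) * ((lam * s * ?F) ^ m / fact m)"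
      using assms(4) by (simp add: c_def power_mult_distrib power2_eq_square)
  qed
  also have "\<dots> = q\<^sup>2 * exp (lam * s + 2 * (lam * z)) * (\<Sum>m\<le>?n. (lam * s * ?F) ^ m / fact m)"
    by (simp only: sum_distrib_left)
  also have "\<dots> \<le> q\<^sup>2 * exp (lam * s + 2 * (lam * z)) * exp (lam * s * ?F)"
    using assms by (intro mult_left_mono sum_power_div_fact_le_exp mult_nonneg_nonneg msg_sum_nonneg) auto
  also have "\<dots> = q\<^sup>2 * exp (lam * s + 2 * lam * (1 - s) * ?W + lam * s * ?F)"
    by (simp only: z_def mult_ac add_ac exp_add[symmetric])
  finally show ?thesis .
qed


text \<open>The recursion bounding both sums has the unstable fixed point \<open>1\<close>, and each level multiplies the
  distance to it by \<open>lam\<close>; the factor \<open>\<rho> > 1\<close> absorbs the quadratic error terms.\<close>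

lemma sums_bounded:
  fixes lam :: real
  assumes "finite V" "0 \<le> p" "0 \<le> s" "s \<le> 1" and lam: "real (card V) * p = lam" "1 \<le> lam"
    and q: "q = exp (\<delta> - lam)" and "0 \<le> \<delta>" "1 < \<rho>"
    and small: "\<delta> * \<rho> * real K * (lam * \<rho>) ^ K \<le> 1 / 2" "\<delta> * \<rho> * real K * (lam * \<rho>) ^ K \<le> (\<rho> - 1) / 2"
  defines "\<eta> \<equiv> \<lambda>k. \<delta> * \<rho> * real k * (lam * \<rho>) ^ k"
  shows "k \<le> K \<Longrightarrow> weight_sum V q p k \<le> 1 + \<eta> k \<and> msg_sum V q p lam s k \<le> 1 + 2 * \<eta> k"
proof (induction k)
  case 0
  then show ?case by (simp add: weight_sum_def msg_sum_def \<eta>_def)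
next
  case (Suc k)
  let ?W = "weight_sum V q p k" and ?F = "msg_sum V q p lam s k"
  \<comment> \<open>With the induction hypothesis inserted, the recursion for the mass gives
    \<open>exp y\<close> and the one for the mean message gives exactly \<open>exp (2 * y)\<close>:
    the terms with \<open>s\<close> cancel.\<close>
  define y where "y = \<delta> + lam * \<eta> k"
  have ge1: "1 \<le> lam * \<rho>" using mult_mono[of 1 lam 1 \<rho>] assms by simp
  have \<eta>0: "0 \<le> \<eta> k" unfolding \<eta>_def using assms by simp
  have y0: "0 \<le> y" using assms \<eta>0 by (simp add: y_def)
  \<comment> \<open>Each level contributes one new term \<open>\<delta> * \<rho>\<close>, bounded
    here by its multiple with the full power of \<open>lam * \<rho>\<close>. This is where the
    factor \<open>k\<close> in \<open>\<eta>\<close> comes from.\<close>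
  have \<rho>y: "\<rho> * y \<le> \<eta> (Suc k)"
  proof -
    have "\<rho> * y = \<delta> * \<rho> * 1 + \<delta> * \<rho> * real k * (lam * \<rho>) ^ Suc k"
      by (simp add: y_def \<eta>_def algebra_simps)
    also have "\<dots> \<le> \<delta> * \<rho> * (lam * \<rho>) ^ Suc k + \<delta> * \<rho> * real k * (lam * \<rho>) ^ Suc k"
      using assms ge1 by (intro add_mono mult_left_mono one_le_power) auto
    finally show ?thesis by (simp add: \<eta>_def algebra_simps)
  qed
  have "\<eta> (Suc k) \<le> \<eta> K"
    unfolding \<eta>_def using Suc.prems assms ge1
    by (intro mult_mono mult_left_mono power_increasing) auto
  moreover have "y \<le> \<rho> * y" using y0 assms mult_right_mono[of 1 \<rho> y] by simp
  ultimately have yK: "y \<le> \<eta> K" using \<rho>y by linarith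
  have y1: "2 * y \<le> 1" "2 * y \<le> \<rho> - 1"
    using yK small(1) yK[THEN order_trans, of "(\<rho> - 1) / 2"] small(2) by (simp_all add: \<eta>_def)
  have "exp (2 * y) \<le> 1 + 2 * y + (2 * y)\<^sup>2" using y0 y1 by (intro exp_bound) auto
  also have "\<dots> = 1 + 2 * (y + 2 * y * y)" by (simp add: power2_eq_square algebra_simps)
  also have "\<dots> \<le> 1 + 2 * (y + (\<rho> - 1) * y)"
    using y0 y1 by (intro add_left_mono mult_left_mono mult_right_mono) auto
  also have "\<dots> = 1 + 2 * (\<rho> * y)" by (simp add: algebra_simps)
  also have "\<dots> \<le> 1 + 2 * \<eta> (Suc k)" using \<rho>y by simp
  finally have e2: "exp (2 * y) \<le> 1 + 2 * \<eta> (Suc k)" .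
  \<comment> \<open>The estimate of \<open>exp (2 * y)\<close> serves both sums, because the square
    of \<open>exp y - 1\<close> is nonnegative.\<close>
  have "2 * exp y \<le> 1 + exp (2 * y)"
  proof -
    have "0 \<le> (exp y - 1)\<^sup>2" by simp
    then show ?thesis by (simp add: exp_double power2_diff)
  qed
  with e2 have e1: "exp y \<le> 1 + \<eta> (Suc k)" by simp
  have W: "?W \<le> 1 + \<eta> k" and F: "?F \<le> 1 + 2 * \<eta> k" using Suc by auto
  have "weight_sum V q p (Suc k) \<le> q * exp (lam * ?W)"
    using weight_sum_Suc_le[of V q p k] assms by simp
  also have "\<dots> \<le> q * exp (lam * (1 + \<eta> k))"
    using assms W by (intro mult_left_mono) auto
  also have "\<dots> = exp y" unfolding q y_def exp_add[symmetric] by (simp add: algebra_simps)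
  finally have W': "weight_sum V q p (Suc k) \<le> 1 + \<eta> (Suc k)" using e1 by simp
  have "msg_sum V q p lam s (Suc k) \<le> q\<^sup>2 * exp (lam * s + 2 * lam * (1 - s) * ?W + lam * s * ?F)"
    using assms by (intro msg_sum_Suc_le) auto
  also have "\<dots> \<le> q\<^sup>2 * exp (lam * s + 2 * lam * (1 - s) * (1 + \<eta> k) + lam * s * (1 + 2 * \<eta> k))"
    using assms W F by (intro mult_left_mono iffD2[OF exp_le_cancel_iff] add_mono) auto
  also have "\<dots> = exp (2 * y)"
    unfolding q y_def power2_eq_square exp_add[symmetric] by (simp add: algebra_simps)
  finally have "msg_sum V q p lam s (Suc k) \<le> 1 + 2 * \<eta> (Suc k)" using e2 by simp
  with W' show ?case by simp
qed

section \<open>First moment estimates in the random graphs\<close>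

definition upair :: "nat \<Rightarrow> nat \<Rightarrow> nat \<times> nat" where
  "upair a b = (min a b, max a b)"

lemma upair_eq_iff: "upair a b = upair c e \<longleftrightarrow> (a = c \<and> b = e) \<or> (a = e \<and> b = c)"
  by (auto simp: upair_def min_def max_def split: if_splits)

definition upairs :: "nat \<Rightarrow> (nat \<times> nat) set" where
  "upairs n = {(i, j). 1 \<le> i \<and> i < j \<and> j \<le> n}"

lemma finite_upairs: "finite (upairs n)"
  by (rule finite_subset[of _ "{..n} \<times> {..n}"]) (auto simp: upairs_def)

lemma upair_in_upairs: "a \<in> {1..n} \<Longrightarrow> b \<in> {1..n} \<Longrightarrow> a \<noteq> b \<Longrightarrow> upair a b \<in> upairs n"
  by (auto simp: upair_def upairs_def min_def max_def)

lemma sym_adj_iff: "sym_adj n e a b \<longleftrightarrow> a \<in> {1..n} \<and> b \<in> {1..n} \<and> a \<noteq> b \<and> e (upair a b)"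
  by (simp add: sym_adj_def upair_def)

lemma symp_sym_adj: "symp (sym_adj n e)" and irreflp_sym_adj: "irreflp (sym_adj n e)"
  by (auto simp: symp_def irreflp_def sym_adj_def min.commute max.commute)

lemma nbrs_sym_adj: "nbrs (sym_adj n e) x \<subseteq> {1..n}"
  by (auto simp: nbrs_def sym_adj_def)

definition path_edges :: "nat list \<Rightarrow> (nat \<times> nat) set" where
  "path_edges l = (\<lambda>k. upair (l ! k) (l ! Suc k)) ` {k. Suc k < length l}"

lemma card_path_edges:
  assumes "distinct l" shows "card (path_edges l) = length l - 1"
proof -
  have "inj_on (\<lambda>k. upair (l ! k) (l ! Suc k)) {k. Suc k < length l}"
    using assms by (intro inj_onI) (auto simp: upair_eq_iff nth_eq_iff_index_eq)
  moreover have "{k. Suc k < length l} = {..<length l - 1}" by auto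
  ultimately show ?thesis by (simp add: path_edges_def card_image)
qed

lemma path_edges_upairs: "distinct l \<Longrightarrow> set l \<subseteq> {1..n} \<Longrightarrow> path_edges l \<subseteq> upairs n"
  unfolding path_edges_def
  by (auto intro!: upair_in_upairs simp: nth_eq_iff_index_eq subset_iff simp del: atLeastAtMost_iff)

lemma successively_path_edges: "successively (sym_adj n e) l \<Longrightarrow> z \<in> path_edges l \<Longrightarrow> e z"
  by (auto simp: path_edges_def successively_conv_nth sym_adj_iff)

text \<open>An ear with interior vertices uses only edges with an end off the path. An ear without
  them is the single edge \<open>y z\<close>, whose ends are not consecutive on the path because
  \<open>A2\<close> is then nonempty.\<close>

lemma path_edges_ear_disjoint:
  assumes "distinct (A1 @ y # A2 @ z # A3)" "set cs \<inter> set (A1 @ y # A2 @ z # A3) = {}" "A2 \<noteq> [] \<or> cs \<noteq> []"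
  shows "path_edges (A1 @ y # A2 @ z # A3) \<inter> path_edges (y # cs @ [z]) = {}"
proof (cases "cs = []")
  case True
  let ?A = "A1 @ y # A2 @ z # A3"
  let ?m = "length A1" and ?m' = "Suc (length A1 + length A2)"
  have nths: "?A ! ?m = y" "?A ! ?m' = z" "?m < length ?A" "?m' < length ?A" by (auto simp: nth_append)
  have "upair y z \<notin> path_edges ?A"
  proof
    assume "upair y z \<in> path_edges ?A"
    then obtain k where k: "Suc k < length ?A" "upair (?A ! ?m) (?A ! ?m') = upair (?A ! k) (?A ! Suc k)"
      unfolding nths by (auto simp: path_edges_def)
    then have "(?m = k \<and> ?m' = Suc k) \<or> (?m = Suc k \<and> ?m' = k)"
      unfolding upair_eq_iff using nths(3,4) assms(1) by (simp only: nth_eq_iff_index_eq Suc_lessD)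
    then show False using assms(3) True by auto
  qed
  moreover have "path_edges (y # cs @ [z]) = {upair y z}" using True by (auto simp: path_edges_def)
  ultimately show ?thesis by simp
next
  case False
  let ?A = "A1 @ y # A2 @ z # A3" and ?C = "y # cs @ [z]"
  have "fst e \<in> set ?A \<and> snd e \<in> set ?A" if "e \<in> path_edges ?A" for e
    using that nth_mem[of _ ?A] by (auto simp: path_edges_def upair_def min_def max_def simp del: set_append)
  moreover have "fst e \<in> set cs \<or> snd e \<in> set cs" if e: "e \<in> path_edges ?C" for e
  proof -
    obtain k where k: "Suc k < length ?C" "e = upair (?C ! k) (?C ! Suc k)" using e by (auto simp: path_edges_def)
    have "?C ! k \<in> set cs \<or> ?C ! Suc k \<in> set cs"
    proof (cases k)
      case 0
      then show ?thesis using False by (cases cs) auto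
    next
      case (Suc k')
      then show ?thesis using k(1) by (auto simp: nth_append)
    qed
    then show ?thesis using k(2) by (auto simp: upair_def min_def max_def)
  qed
  ultimately show ?thesis using assms(2) by blast
qed

lemma walk_contains_path:
  "(G ^^ k) y z \<Longrightarrow> \<exists>l. l \<noteq> [] \<and> distinct l \<and> successively G l \<and> hd l = y \<and> last l = z \<and> length l \<le> Suc k"
proof (induction k arbitrary: z)
  case 0
  then show ?case by (intro exI[of _ "[y]"]) auto
next
  case (Suc k)
  then obtain w where w: "(G ^^ k) y w" "G w z" by auto
  then obtain l where l: "l \<noteq> []" "distinct l" "successively G l" "hd l = y" "last l = w" "length l \<le> Suc k"
    using Suc.IH by blast
  show ?case
  proof (cases "z \<in> set l")
    case True
    then obtain a b where ab: "l = (a @ [z]) @ b" by (auto dest: split_list)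
    then have "successively G (a @ [z])" "hd (a @ [z]) = y" using l by (auto simp: successively_append_iff hd_append)
    then show ?thesis using l ab by (intro exI[of _ "a @ [z]"]) auto
  next
    case False
    then show ?thesis using l w by (intro exI[of _ "l @ [z]"]) (auto simp: successively_append_iff hd_append)
  qed
qed

lemma relpowp_symp: "symp G \<Longrightarrow> (G ^^ k) x y \<Longrightarrow> (G ^^ k) y x"
proof (induction k arbitrary: y)
  case (Suc k)
  then obtain w where "(G ^^ k) x w" "G w y" by auto
  then have "(G ^^ k) w x" "G y w" using Suc by (auto simp: symp_def)
  then show ?case by (meson relpowp_Suc_I2)
qed simp

lemma ball_sym_adj_subset:
  assumes "x \<in> {1..n}" shows "ball_graph (sym_adj n e) x d \<subseteq> {1..n}"
proof
  fix y assume "y \<in> ball_graph (sym_adj n e) x d"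
  then obtain k where "(sym_adj n e ^^ k) x y" by (auto simp: ball_graph_def)
  then show "y \<in> {1..n}" using assms by (cases k) (auto simp: sym_adj_def)
qed

lemma markov_count:
  fixes M :: "'a pmf"
  assumes "finite K" "0 < r"
  shows "measure_pmf.prob M {X. r \<le> real (card {\<kappa>\<in>K. X \<in> B \<kappa>})} \<le> (\<Sum>\<kappa>\<in>K. measure_pmf.prob M (B \<kappa>)) / r"
proof -
  let ?u = "\<lambda>X. \<Sum>\<kappa>\<in>K. indicator (B \<kappa>) X :: real"
  have u: "real (card {\<kappa>\<in>K. X \<in> B \<kappa>}) = ?u X" for X
    using assms(1) by (simp add: indicator_def sum.If_cases Int_def conj_commute)
  have int: "integrable (measure_pmf M) ?u"
    by (intro Bochner_Integration.integrable_sum integrable_real_indicator)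
       (auto simp: measure_pmf.emeasure_eq_measure)
  have "measure_pmf.prob M {X \<in> space (measure_pmf M). r \<le> ?u X} \<le> (\<integral>X. ?u X \<partial>measure_pmf M) / r"
    using assms(2) int
    by (intro integral_Markov_inequality_measure[where A = "space (measure_pmf M)"])
       (auto intro!: sum_nonneg)
  also have "(\<integral>X. ?u X \<partial>measure_pmf M) = (\<Sum>\<kappa>\<in>K. measure_pmf.prob M (B \<kappa>))"
    by (subst Bochner_Integration.integral_sum)
       (auto simp: measure_pmf.emeasure_eq_measure intro!: integrable_real_indicator)
  finally show ?thesis by (simp add: u)
qed

locale corr_model =
  fixes n :: nat and lam s :: real
  assumes lam: "1 \<le> lam" and s: "0 \<le> s" "s \<le> 1" and n: "lam * (2 - s) \<le> real n"
begin

definition p :: real where "p = lam / real n"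

definition entries_pmf :: "(nat \<times> nat \<Rightarrow> bool \<times> bool) pmf" where
  "entries_pmf = Pi_pmf (upairs n) (False, False) (\<lambda>_. edge_pmf n lam s)"

abbreviation G1 :: "(nat \<times> nat \<Rightarrow> bool \<times> bool) \<Rightarrow> graph" where
  "G1 X \<equiv> sym_adj n (fst \<circ> X)"

abbreviation G2 :: "(nat \<times> nat \<Rightarrow> bool \<times> bool) \<Rightarrow> graph" where
  "G2 X \<equiv> sym_adj n (snd \<circ> X)"

lemma lam_le_n: "lam \<le> real n"
  using n mult_left_mono[of 1 "2 - s" lam] s lam by linarith

lemma n_pos: "0 < n" using lam_le_n lam by (cases n) auto

lemma p_bounds: "0 < p" "p \<le> 1" "real n * p = lam"
  using lam lam_le_n n_pos by (auto simp: p_def)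

lemma prob_edge:
  "measure_pmf.prob (edge_pmf n lam s) {x. fst x} = p"
  "measure_pmf.prob (edge_pmf n lam s) {x. snd x} = p"
  "measure_pmf.prob (edge_pmf n lam s) {x. \<not> fst x} = 1 - p"
  "measure_pmf.prob (edge_pmf n lam s) {x. \<not> snd x} = 1 - p"
proof -
  have sets: "{x. fst x} = {(True, True), (True, False)}" "{x. snd x} = {(True, True), (False, True)}"
    "{x. \<not> fst x} = {(False, True), (False, False)}" "{x. \<not> snd x} = {(True, False), (False, False)}"
    by auto
  note pm = pmf_edge_pmf[of lam s n]
  show "measure_pmf.prob (edge_pmf n lam s) {x. fst x} = p"
    "measure_pmf.prob (edge_pmf n lam s) {x. snd x} = p"
    "measure_pmf.prob (edge_pmf n lam s) {x. \<not> fst x} = 1 - p"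
    "measure_pmf.prob (edge_pmf n lam s) {x. \<not> snd x} = 1 - p"
    unfolding sets using pm lam s n n_pos
    by (auto simp: measure_measure_pmf_finite p_def field_simps)
qed

text \<open>The four sets are disjoint, so each pair of vertices is tested in at most one of its two
  coordinates. The correlation inside a pair never enters, and independence over the pairs gives a
  product of marginals.\<close>

lemma cylinder_prob:
  assumes "E1 \<subseteq> upairs n" "E2 \<subseteq> upairs n" "Z1 \<subseteq> upairs n" "Z2 \<subseteq> upairs n"
    and "E1 \<inter> E2 = {}" "E1 \<inter> Z1 = {}" "E1 \<inter> Z2 = {}" "E2 \<inter> Z1 = {}" "E2 \<inter> Z2 = {}" "Z1 \<inter> Z2 = {}"
  shows "measure_pmf.prob entries_pmf {X. (\<forall>e\<in>E1. fst (X e)) \<and> (\<forall>e\<in>E2. snd (X e)) \<and>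
      (\<forall>e\<in>Z1. \<not> fst (X e)) \<and> (\<forall>e\<in>Z2. \<not> snd (X e))} \<le>
    p ^ (card E1 + card E2) * (1 - p) ^ (card Z1 + card Z2)"
proof -
  define B where "B = (\<lambda>e. if e \<in> E1 then {x. fst x} else if e \<in> E2 then {x. snd x}
    else if e \<in> Z1 then {x. \<not> fst x} else if e \<in> Z2 then {x. \<not> snd x} else (UNIV :: (bool \<times> bool) set))"
  have I: "upairs n \<inter> E1 = E1" "upairs n \<inter> E2 = E2" "upairs n \<inter> Z1 = Z1" "upairs n \<inter> Z2 = Z2"
    using assms by auto
  have pr: "(\<Prod>e\<in>upairs n. if e \<in> E then c else 1) = c ^ card (upairs n \<inter> E)" for E and c :: real
    by (simp add: prod.If_cases finite_upairs)
  have "measure_pmf.prob entries_pmf {X. (\<forall>e\<in>E1. fst (X e)) \<and> (\<forall>e\<in>E2. snd (X e)) \<and>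
      (\<forall>e\<in>Z1. \<not> fst (X e)) \<and> (\<forall>e\<in>Z2. \<not> snd (X e))} \<le> measure_pmf.prob entries_pmf (Pi (upairs n) B)"
    using assms by (intro measure_pmf.finite_measure_mono) (auto simp: B_def)
  also have "\<dots> = (\<Prod>e\<in>upairs n. measure_pmf.prob (edge_pmf n lam s) (B e))"
    unfolding entries_pmf_def by (rule measure_Pi_pmf_Pi[OF finite_upairs])
  also have "\<dots> = (\<Prod>e\<in>upairs n. (if e \<in> E1 then p else 1) * (if e \<in> E2 then p else 1) *
      (if e \<in> Z1 then 1 - p else 1) * (if e \<in> Z2 then 1 - p else 1))"
    using assms by (intro prod.cong refl) (auto simp: B_def prob_edge)
  also have "\<dots> = p ^ (card E1 + card E2) * (1 - p) ^ (card Z1 + card Z2)"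
    by (simp add: prod.distrib pr I power_add)
  finally show ?thesis .
qed

lemma path_prob:
  assumes "E1 \<subseteq> upairs n" "E2 \<subseteq> upairs n" "E1 \<inter> E2 = {}"
  shows "measure_pmf.prob entries_pmf {X. (\<forall>e\<in>E1. fst (X e)) \<and> (\<forall>e\<in>E2. snd (X e))} \<le> p ^ (card E1 + card E2)"
  using cylinder_prob[of E1 E2 "{}" "{}"] assms by simp

text \<open>Two points of a ball of radius \<open>d\<close> are joined by a path of length at most \<open>2d\<close>, hence a first
  moment bound on such paths replaces a second moment bound on the size of the ball.\<close>

lemma ball_size_prob_aux:
  fixes \<pi> :: "bool \<times> bool \<Rightarrow> bool"
  assumes \<pi>: "\<And>E. E \<subseteq> upairs n \<Longrightarrow> measure_pmf.prob entries_pmf {X. \<forall>e\<in>E. \<pi> (X e)} \<le> p ^ card E"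
    and "0 < r"
  shows "measure_pmf.prob entries_pmf {X. \<exists>x\<in>{1..n}. r < real (card (ball_graph (sym_adj n (\<pi> \<circ> X)) x d))} \<le>
    real n * (2 * real d + 1) * lam ^ (2 * d) / r\<^sup>2"
proof -
  define L where "L = (\<lambda>a. {l. distinct l \<and> set l \<subseteq> {1..n} \<and> length l = Suc a})"
  define K where "K = (\<Union>a\<in>{..2 * d}. L a)"
  define B where "B = (\<lambda>l. {X. \<forall>e\<in>path_edges l. \<pi> (X e)})"
  have Lsub: "L a \<subseteq> {l. set l \<subseteq> {1..n} \<and> length l = Suc a}" for a by (auto simp: L_def)
  have finL: "finite (L a)" for a
    by (rule finite_subset[OF Lsub]) (auto intro: finite_lists_length_eq)
  have cardL: "card (L a) \<le> n ^ Suc a" for a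
    using card_mono[OF finite_lists_length_eq Lsub] by (simp add: card_lists_length_eq)
  have finK: "finite K" using finL by (simp add: K_def)
  have sub: "{X. \<exists>x\<in>{1..n}. r < real (card (ball_graph (sym_adj n (\<pi> \<circ> X)) x d))} \<subseteq>
      {X. r\<^sup>2 \<le> real (card {l\<in>K. X \<in> B l})}"
  proof
    fix X assume "X \<in> {X. \<exists>x\<in>{1..n}. r < real (card (ball_graph (sym_adj n (\<pi> \<circ> X)) x d))}"
    then obtain x where x: "x \<in> {1..n}" "r < real (card (ball_graph (sym_adj n (\<pi> \<circ> X)) x d))" by auto
    let ?G = "sym_adj n (\<pi> \<circ> X)"
    let ?b = "ball_graph ?G x d"
    have b: "?b \<subseteq> {1..n}" using x(1) by (rule ball_sym_adj_subset)
    have "?b \<times> ?b \<subseteq> (\<lambda>l. (hd l, last l)) ` {l\<in>K. X \<in> B l}"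
    proof
      fix yz assume "yz \<in> ?b \<times> ?b"
      then obtain y z where yz: "yz = (y, z)" "y \<in> ?b" "z \<in> ?b" by auto
      then obtain k k' where k: "k \<le> d" "(?G ^^ k) x y" "k' \<le> d" "(?G ^^ k') x z"
        by (auto simp: ball_graph_def)
      have "(?G ^^ (k + k')) y z"
        using relpowp_symp[OF symp_sym_adj k(2)] k(4) by (auto simp: relpowp_add)
      from walk_contains_path[OF this] obtain l where l: "l \<noteq> []" "distinct l" "successively ?G l"
        "hd l = y" "last l = z" "length l \<le> Suc (k + k')" by blast
      have "set l \<subseteq> {1..n}"
      proof
        fix a assume "a \<in> set l"
        moreover have "set l \<subseteq> ball_graph ?G y (k + k')" using path_in_ball[OF l(3,1,6)] l(4) by simp
        moreover have "y \<in> {1..n}" using yz b by auto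
        ultimately show "a \<in> {1..n}" using ball_sym_adj_subset[of y] by blast
      qed
      moreover have "length l = Suc (length l - 1)" "length l - 1 \<le> 2 * d" using l k by auto
      ultimately have "l \<in> K" using l(2) unfolding K_def L_def by blast
      moreover have "X \<in> B l" using successively_path_edges[OF l(3)] by (auto simp: B_def)
      ultimately show "yz \<in> (\<lambda>l. (hd l, last l)) ` {l\<in>K. X \<in> B l}" using l yz by auto
    qed
    then have "card (?b \<times> ?b) \<le> card {l\<in>K. X \<in> B l}"
      using finK by (intro surj_card_le) auto
    then have "real (card ?b) * real (card ?b) \<le> real (card {l\<in>K. X \<in> B l})"
      by (simp add: card_cartesian_product flip: of_nat_mult)
    moreover have "r\<^sup>2 \<le> real (card ?b) * real (card ?b)"
      using x(2) assms(2) unfolding power2_eq_square by (intro mult_mono) auto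
    ultimately show "X \<in> {X. r\<^sup>2 \<le> real (card {l\<in>K. X \<in> B l})}" by simp
  qed
  have "measure_pmf.prob entries_pmf {X. \<exists>x\<in>{1..n}. r < real (card (ball_graph (sym_adj n (\<pi> \<circ> X)) x d))} \<le>
      measure_pmf.prob entries_pmf {X. r\<^sup>2 \<le> real (card {l\<in>K. X \<in> B l})}"
    using sub by (intro measure_pmf.finite_measure_mono) auto
  also have "\<dots> \<le> (\<Sum>l\<in>K. measure_pmf.prob entries_pmf (B l)) / r\<^sup>2"
    using finK assms(2) by (intro markov_count) auto
  also have "(\<Sum>l\<in>K. measure_pmf.prob entries_pmf (B l)) = (\<Sum>a\<le>2 * d. \<Sum>l\<in>L a. measure_pmf.prob entries_pmf (B l))"
    unfolding K_def using finL by (intro sum.UNION_disjoint) (auto simp: L_def)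
  also have "\<dots> \<le> (\<Sum>a\<le>2 * d. real n * lam ^ (2 * d))"
  proof (rule sum_mono)
    fix a assume a: "a \<in> {..2 * d}"
    have "(\<Sum>l\<in>L a. measure_pmf.prob entries_pmf (B l)) \<le> (\<Sum>l\<in>L a. p ^ a)"
    proof (rule sum_mono)
      fix l assume "l \<in> L a"
      then show "measure_pmf.prob entries_pmf (B l) \<le> p ^ a"
        using \<pi>[of "path_edges l"] path_edges_upairs[of l n] card_path_edges[of l] by (auto simp: L_def B_def)
    qed
    also have "\<dots> = real (card (L a)) * p ^ a" by simp
    also have "\<dots> \<le> real (n ^ Suc a) * p ^ a"
      using cardL[of a] p_bounds by (intro mult_right_mono of_nat_mono) auto
    also have "\<dots> = real n * (real n * p) ^ a" by (simp add: power_mult_distrib)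
    also have "\<dots> \<le> real n * lam ^ (2 * d)"
      using a lam p_bounds by (intro mult_left_mono) (auto intro!: power_increasing)
    finally show "(\<Sum>l\<in>L a. measure_pmf.prob entries_pmf (B l)) \<le> real n * lam ^ (2 * d)" .
  qed
  also have "\<dots> = real n * (2 * real d + 1) * lam ^ (2 * d)" by (simp add: algebra_simps)
  finally show ?thesis using assms(2) by (simp add: divide_right_mono comp_def)
qed

lemma ball_size_prob:
  assumes "0 < r"
  shows "measure_pmf.prob entries_pmf {X. \<exists>x\<in>{1..n}. r < real (card (ball_graph (G1 X) x d))} \<le>
      real n * (2 * real d + 1) * lam ^ (2 * d) / r\<^sup>2"
    and "measure_pmf.prob entries_pmf {X. \<exists>x\<in>{1..n}. r < real (card (ball_graph (G2 X) x d))} \<le>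
      real n * (2 * real d + 1) * lam ^ (2 * d) / r\<^sup>2"
  using path_prob[of _ "{}"] path_prob[of "{}"] assms by (intro ball_size_prob_aux; simp)+

end

text \<open>Only the ear is kept from the second path, because it is the part sure to share no edge
  with the first. An ear with \<open>length cs\<close> interior vertices has one more edge, hence
  the strict bound: path and ear have at most \<open>2 * d\<close> edges each.\<close>

definition chorded :: "graph \<Rightarrow> graph \<Rightarrow> nat \<Rightarrow> nat \<Rightarrow> bool" where
  "chorded G H d i \<longleftrightarrow> (\<exists>A1 y A2 z A3 cs. let A = A1 @ y # A2 @ z # A3 in
     distinct A \<and> successively G A \<and> i \<in> set A \<and> length A \<le> 2 * d + 1 \<and>
     distinct cs \<and> set cs \<inter> set A = {} \<and> (A2 \<noteq> [] \<or> cs \<noteq> []) \<and>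
     successively H (y # cs @ [z]) \<and> length cs < 2 * d)"

lemma two_paths_chorded:
  assumes "distinct A" "distinct B" "A \<noteq> []" "B \<noteq> []" "hd A = hd B" "last A = last B" "A \<noteq> B"
    and "successively G A" "successively H B" "i \<in> set A" "length A \<le> 2 * d + 1" "length B \<le> 2 * d + 1"
  shows "chorded G H d i"
proof -
  obtain A1 y A2 z A3 cs B2 where *: "A = A1 @ y # A2 @ z # A3" "B = A1 @ y # cs @ z # B2"
      "set cs \<inter> set A = {}" "A2 \<noteq> [] \<or> cs \<noteq> []"
    using ear_decomposition[OF assms(1-7)] by metis
  have "successively H (y # cs @ [z])"
    using successively_infix[of H A1 "y # cs @ [z]" B2] assms(9) *(2) by simp
  moreover have "distinct cs" "length cs < 2 * d" using assms(2,12) unfolding *(2) by auto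
  ultimately show ?thesis
    using assms(1,8,10,11) *(3,4) unfolding chorded_def Let_def *(1) by blast
qed

context corr_model
begin

text \<open>A path with \<open>a\<close> edges and an ear with \<open>c\<close> interior vertices
  have \<open>a + c + 1\<close> vertices and as many edges, so the powers of \<open>n\<close> and
  \<open>p\<close> combine into a power of \<open>lam\<close>. The fifth power of
  \<open>2 * d + 1\<close> consists of three factors for the positions of \<open>i\<close>,
  \<open>y\<close>, \<open>z\<close> on the path and two for the choice of \<open>a\<close> and
  \<open>c\<close>.\<close>

lemma chord_prob:
  assumes "0 < r"
  shows "measure_pmf.prob entries_pmf {X. r \<le> real (card {i\<in>{1..n}. chorded (G1 X) (G2 X) d i})} \<le>
    (2 * real d + 1) ^ 5 * lam ^ (4 * d) / r"
proof -
  define L where "L = (\<lambda>a. {l. distinct l \<and> set l \<subseteq> {1..n} \<and> length l = a})"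
  define S where "S = (\<lambda>a c. SIGMA A:L (Suc a). set A \<times> set A \<times> set A \<times> L c)"
  define good where "good = (\<lambda>(A, i :: nat, y, z, cs). distinct (y # cs @ [z]) \<and>
      path_edges A \<inter> path_edges (y # cs @ [z]) = {})"
  define K where "K = (\<Union>(a, c)\<in>{..2 * d} \<times> {..<2 * d}. {\<kappa> \<in> S a c. good \<kappa>})"
  define B where "B = (\<lambda>(A, i :: nat, y, z, cs). {X :: nat \<times> nat \<Rightarrow> bool \<times> bool.
      (\<forall>e\<in>path_edges A. fst (X e)) \<and> (\<forall>e\<in>path_edges (y # cs @ [z]). snd (X e))})"
  have Lsub: "L a \<subseteq> {l. set l \<subseteq> {1..n} \<and> length l = a}" for a by (auto simp: L_def)
  have finL: "finite (L a)" for a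
    by (rule finite_subset[OF Lsub]) (auto intro: finite_lists_length_eq)
  have cardL: "card (L a) \<le> n ^ a" for a
    using card_mono[OF finite_lists_length_eq Lsub] by (simp add: card_lists_length_eq)
  have finS: "finite (S a c)" for a c using finL by (simp add: S_def)
  have cardS: "card (S a c) \<le> n ^ Suc a * (Suc a ^ 3 * n ^ c)" for a c
  proof -
    have "card (S a c) = (\<Sum>A\<in>L (Suc a). card (set A \<times> set A \<times> set A \<times> L c))"
      unfolding S_def using finL by (intro card_SigmaI) auto
    also have "\<dots> = (\<Sum>A\<in>L (Suc a). Suc a ^ 3 * card (L c))"
      by (intro sum.cong refl)
         (auto simp: card_cartesian_product L_def distinct_card power3_eq_cube algebra_simps)
    also have "\<dots> = card (L (Suc a)) * (Suc a ^ 3 * card (L c))" by simp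
    also have "\<dots> \<le> n ^ Suc a * (Suc a ^ 3 * n ^ c)" by (intro mult_mono cardL) auto
    finally show ?thesis .
  qed
  have finK: "finite K" using finS by (auto simp: K_def)
  have B: "measure_pmf.prob entries_pmf (B \<kappa>) \<le> p ^ (a + Suc c)" if "\<kappa> \<in> S a c" "good \<kappa>" for \<kappa> a c
  proof -
    obtain A i y z cs where \<kappa>: "\<kappa> = (A, i, y, z, cs)" by (cases \<kappa>)
    have h: "distinct A" "set A \<subseteq> {1..n}" "length A = Suc a" "set (y # cs @ [z]) \<subseteq> {1..n}"
      "length (y # cs @ [z]) = c + 2" "distinct (y # cs @ [z])" "path_edges A \<inter> path_edges (y # cs @ [z]) = {}"
      using that unfolding \<kappa> S_def L_def good_def by auto
    have "card (path_edges A) + card (path_edges (y # cs @ [z])) = a + Suc c"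
      using h by (simp only: card_path_edges)
    then show ?thesis
      using path_prob[OF path_edges_upairs[OF h(1,2)] path_edges_upairs[OF h(6,4)] h(7)] by (simp add: B_def \<kappa>)
  qed
  have sub: "{X. r \<le> real (card {i\<in>{1..n}. chorded (G1 X) (G2 X) d i})} \<subseteq>
      {X. r \<le> real (card {\<kappa>\<in>K. X \<in> B \<kappa>})}"
  proof
    fix X assume X: "X \<in> {X. r \<le> real (card {i\<in>{1..n}. chorded (G1 X) (G2 X) d i})}"
    have "{i\<in>{1..n}. chorded (G1 X) (G2 X) d i} \<subseteq> (\<lambda>(A, i, y, z, cs). i) ` {\<kappa>\<in>K. X \<in> B \<kappa>}"
    proof
      fix i assume "i \<in> {i\<in>{1..n}. chorded (G1 X) (G2 X) d i}"
      then obtain A1 y A2 z A3 cs A where A: "A = A1 @ y # A2 @ z # A3"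
        "distinct A" "successively (G1 X) A" "i \<in> set A" "length A \<le> 2 * d + 1"
        "distinct cs" "set cs \<inter> set A = {}" "A2 \<noteq> [] \<or> cs \<noteq> []"
        "successively (G2 X) (y # cs @ [z])" "length cs < 2 * d"
        unfolding chorded_def Let_def by blast
      have rng: "set l \<subseteq> {1..n}" if "successively (sym_adj n e) l" "2 \<le> length l" for e l
      proof
        fix a assume "a \<in> set l"
        then obtain k where k: "k < length l" "l ! k = a" by (auto simp: in_set_conv_nth)
        show "a \<in> {1..n}"
        proof (cases k)
          case 0
          then have "sym_adj n e (l ! k) (l ! Suc k)"
            using that by (auto simp: successively_conv_nth)
          then show ?thesis using k by (simp add: sym_adj_def)
        next
          case (Suc k')
          then have "sym_adj n e (l ! k') (l ! k)"
            using that k by (auto simp: successively_conv_nth)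
          then show ?thesis using k by (simp add: sym_adj_def)
        qed
      qed
      have "set A \<subseteq> {1..n}" using rng[OF A(3)] A(1) by simp
      moreover have "set cs \<subseteq> {1..n}" using rng[OF A(9)] by simp
      moreover have "length A = Suc (length A - 1)" using A(1) by simp
      ultimately have "(A, i, y, z, cs) \<in> S (length A - 1) (length cs)"
        using A unfolding S_def L_def by auto
      moreover have "good (A, i, y, z, cs)"
        using path_edges_ear_disjoint[of A1 y A2 z A3 cs] A unfolding good_def by auto
      moreover have "(length A - 1, length cs) \<in> {..2 * d} \<times> {..<2 * d}" using A by auto
      ultimately have "(A, i, y, z, cs) \<in> K" unfolding K_def by blast
      moreover have "X \<in> B (A, i, y, z, cs)"
        using successively_path_edges[OF A(3)] successively_path_edges[OF A(9)] by (auto simp: B_def)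
      ultimately show "i \<in> (\<lambda>(A, i, y, z, cs). i) ` {\<kappa>\<in>K. X \<in> B \<kappa>}" by force
    qed
    then have "card {i\<in>{1..n}. chorded (G1 X) (G2 X) d i} \<le> card {\<kappa>\<in>K. X \<in> B \<kappa>}"
      using finK by (intro surj_card_le) auto
    then show "X \<in> {X. r \<le> real (card {\<kappa>\<in>K. X \<in> B \<kappa>})}" using X by simp
  qed
  have "measure_pmf.prob entries_pmf {X. r \<le> real (card {i\<in>{1..n}. chorded (G1 X) (G2 X) d i})} \<le>
      measure_pmf.prob entries_pmf {X. r \<le> real (card {\<kappa>\<in>K. X \<in> B \<kappa>})}"
    using sub by (intro measure_pmf.finite_measure_mono) auto
  also have "\<dots> \<le> (\<Sum>\<kappa>\<in>K. measure_pmf.prob entries_pmf (B \<kappa>)) / r"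
    using finK assms by (intro markov_count) auto
  also have "(\<Sum>\<kappa>\<in>K. measure_pmf.prob entries_pmf (B \<kappa>)) \<le> (2 * real d + 1) ^ 5 * lam ^ (4 * d)"
  proof -
    have "(\<Sum>\<kappa>\<in>K. measure_pmf.prob entries_pmf (B \<kappa>)) =
        (\<Sum>(a, c)\<in>{..2 * d} \<times> {..<2 * d}. \<Sum>\<kappa>\<in>{\<kappa> \<in> S a c. good \<kappa>}. measure_pmf.prob entries_pmf (B \<kappa>))"
      unfolding K_def using finS
      by (subst sum.UNION_disjoint) (auto simp: S_def L_def case_prod_unfold)
    also have "\<dots> \<le> (\<Sum>(a, c)\<in>{..2 * d} \<times> {..<2 * d}. (2 * real d + 1) ^ 3 * lam ^ (4 * d))"
    proof (rule sum_mono)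
      fix x :: "nat \<times> nat" assume "x \<in> {..2 * d} \<times> {..<2 * d}"
      then obtain a c where x: "x = (a, c)" and ac: "a \<in> {..2 * d}" "c \<in> {..<2 * d}" by auto
      have "(\<Sum>\<kappa>\<in>{\<kappa> \<in> S a c. good \<kappa>}. measure_pmf.prob entries_pmf (B \<kappa>)) \<le> (\<Sum>\<kappa>\<in>{\<kappa> \<in> S a c. good \<kappa>}. p ^ (a + Suc c))"
        using B by (intro sum_mono) auto
      also have "\<dots> = real (card {\<kappa> \<in> S a c. good \<kappa>}) * p ^ (a + Suc c)" by simp
      also have "\<dots> \<le> real (n ^ Suc a * (Suc a ^ 3 * n ^ c)) * p ^ (a + Suc c)"
      proof (intro mult_right_mono of_nat_mono)
        have "card {\<kappa> \<in> S a c. good \<kappa>} \<le> card (S a c)" using finS by (intro card_mono) auto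
        then show "card {\<kappa> \<in> S a c. good \<kappa>} \<le> n ^ Suc a * (Suc a ^ 3 * n ^ c)" using cardS order_trans by blast
      qed (use p_bounds in auto)
      also have "\<dots> = real (Suc a) ^ 3 * (real n * p) ^ (a + Suc c)"
        by (simp add: power_add power_mult_distrib algebra_simps)
      also have "\<dots> = real (Suc a) ^ 3 * lam ^ (a + Suc c)" using p_bounds by simp
      also have "\<dots> \<le> (2 * real d + 1) ^ 3 * lam ^ (4 * d)"
        using ac lam by (intro mult_mono power_mono power_increasing) auto
      finally show "(case x of (a, c) \<Rightarrow> \<Sum>\<kappa>\<in>{\<kappa> \<in> S a c. good \<kappa>}. measure_pmf.prob entries_pmf (B \<kappa>)) \<le>
        (case x of (a, c) \<Rightarrow> (2 * real d + 1) ^ 3 * lam ^ (4 * d))" by (simp add: x)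
    qed
    also have "\<dots> = (2 * real d + 1) * (2 * real d) * ((2 * real d + 1) ^ 3 * lam ^ (4 * d))"
      by (simp add: card_cartesian_product algebra_simps)
    also have "\<dots> \<le> (2 * real d + 1) * (2 * real d + 1) * ((2 * real d + 1) ^ 3 * lam ^ (4 * d))"
      using lam by (intro mult_mono) auto
    also have "\<dots> = (2 * real d + 1) ^ 5 * lam ^ (4 * d)" by (simp add: eval_nat_numeral)
    finally show ?thesis .
  qed
  finally show ?thesis using assms by (simp add: divide_right_mono)
qed

end

section \<open>The law of explored trees\<close>

text \<open>These are the vertices whose whole neighbourhood has been revealed. Leaves are known to
  be present, but nothing about their further neighbours has been used.\<close>

primrec inner_verts :: "rtree \<Rightarrow> nat \<Rightarrow> nat set" where
  "inner_verts Leaf = (\<lambda>x. {})"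
| "inner_verts (Node S f) = (\<lambda>x. insert x (\<Union>y\<in>S. inner_verts (f y) y))"

primrec tree_edges :: "rtree \<Rightarrow> nat \<Rightarrow> (nat \<times> nat) set" where
  "tree_edges Leaf = (\<lambda>x. {})"
| "tree_edges (Node S f) = (\<lambda>x. upair x ` S \<union> (\<Union>y\<in>S. tree_edges (f y) y))"

lemma inner_verts_subset_verts: "inner_verts t x \<subseteq> verts t x"
  by (induction t arbitrary: x) fastforce+

lemma verts_trees: "finite V \<Longrightarrow> t \<in> trees V k \<Longrightarrow> x \<in> V \<Longrightarrow> verts t x \<subseteq> V"
proof (induction k arbitrary: t x)
  case (Suc k)
  then obtain S f where t: "t = Node S f" "S \<subseteq> V" "f \<in> S \<rightarrow>\<^sub>E trees V k" by auto
  then have "verts (f y) y \<subseteq> V" if "y \<in> S" for y using that Suc by (intro Suc.IH) auto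
  then show ?case using t Suc by auto
qed simp

lemma tree_edges_subset:
  "proper t x \<Longrightarrow> tree_edges t x \<subseteq> {(a, b). a \<in> verts t x \<and> b \<in> verts t x \<and> a < b}"
proof (induction t arbitrary: x)
  case (Node S f)
  have sub: "tree_edges (f y) y \<subseteq> {(a, b). a \<in> verts (f y) y \<and> b \<in> verts (f y) y \<and> a < b}" if "y \<in> S" for y
    using Node that by auto
  have root: "upair x y \<in> {(a, b). a \<in> verts (Node S f) x \<and> b \<in> verts (Node S f) x \<and> a < b}" if "y \<in> S" for y
  proof -
    have "y \<in> verts (f y) y" "x \<notin> verts (f y) y" using Node.prems that by auto
    then have "x \<noteq> y" by auto
    moreover have "y \<in> (\<Union>z\<in>S. verts (f z) z)" using that by (rule UN_I) simp
    then have "x \<in> verts (Node S f) x" "y \<in> verts (Node S f) x" by auto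
    ultimately show ?thesis by (auto simp: upair_def min_def max_def)
  qed
  show ?case
  proof
    fix z assume "z \<in> tree_edges (Node S f) x"
    then have "z \<in> upair x ` S \<union> (\<Union>y\<in>S. tree_edges (f y) y)" by simp
    then consider y where "y \<in> S" "z = upair x y" | y where "y \<in> S" "z \<in> tree_edges (f y) y"
      by (elim UnE imageE UN_E)
    then show "z \<in> {(a, b). a \<in> verts (Node S f) x \<and> b \<in> verts (Node S f) x \<and> a < b}"
    proof cases
      case 1
      then show ?thesis using root[OF 1(1)] by (simp only:)
    next
      case 2
      have "verts (f y) y \<subseteq> (\<Union>y\<in>S. verts (f y) y)" using 2(1) by (rule UN_upper)
      then have "verts (f y) y \<subseteq> verts (Node S f) x" by (simp add: subset_insertI2)
      then show ?thesis using sub[OF 2(1)] 2(2) by (auto simp del: verts.simps)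
    qed
  qed
qed simp

text \<open>Distinct labels make the edge sets and inner vertex sets of the subtrees disjoint, so
  the recursive weight counts one \<open>p\<close> for each edge and one \<open>q\<close> for each
  revealed neighbourhood.\<close>

lemma tree_weight_eq:
  assumes "finite V"
  shows "t \<in> trees V k \<Longrightarrow> x \<in> V \<Longrightarrow> proper t x \<Longrightarrow>
    tree_weight q p t = q ^ card (inner_verts t x) * p ^ card (tree_edges t x)"
proof (induction k arbitrary: t x)
  case (Suc k)
  then obtain S f where t: "t = Node S f" "S \<subseteq> V" "f \<in> S \<rightarrow>\<^sub>E trees V k" by auto
  have pr: "x \<notin> verts (f y) y" "proper (f y) y" if "y \<in> S" for y using that Suc.prems(3) t by auto
  have disj: "verts (f y) y \<inter> verts (f y') y' = {}" if "y \<in> S" "y' \<in> S" "y \<noteq> y'" for y y'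
    using that Suc.prems(3) t by (auto simp: disjoint_family_on_def)
  have finS: "finite S" using t assms finite_subset by auto
  have sub: "verts (f y) y \<subseteq> V" if "y \<in> S" for y
    using that t assms by (intro verts_trees[of V _ k]) auto
  have fv: "finite (verts (f y) y)" if "y \<in> S" for y using sub[OF that] assms finite_subset by auto
  have fi: "finite (inner_verts (f y) y)" if "y \<in> S" for y
    using inner_verts_subset_verts fv[OF that] finite_subset by metis
  have te: "tree_edges (f y) y \<subseteq> verts (f y) y \<times> verts (f y) y" if "y \<in> S" for y
    using tree_edges_subset[OF pr(2)[OF that]] by auto
  have ft: "finite (tree_edges (f y) y)" if "y \<in> S" for y
    using te[OF that] fv[OF that] by (meson finite_SigmaI finite_subset)
  have "card (inner_verts t x) = Suc (card (\<Union>y\<in>S. inner_verts (f y) y))"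
    unfolding t(1) inner_verts.simps using finS fi pr(1) inner_verts_subset_verts by (intro card_insert_disjoint) blast+
  also have "card (\<Union>y\<in>S. inner_verts (f y) y) = (\<Sum>y\<in>S. card (inner_verts (f y) y))"
    using finS fi disj inner_verts_subset_verts by (intro card_UN_disjoint) (auto, blast)
  finally have ci: "card (inner_verts t x) = Suc (\<Sum>y\<in>S. card (inner_verts (f y) y))" .
  have "card (tree_edges t x) = card (upair x ` S) + card (\<Union>y\<in>S. tree_edges (f y) y)"
  proof -
    have "upair x y \<notin> tree_edges (f y') y'" if "y' \<in> S" for y y'
      using te[OF that] pr(1)[OF that] by (auto simp: upair_def min_def max_def)
    then show ?thesis
      unfolding t(1) tree_edges.simps using finS ft by (intro card_Un_disjoint) auto
  qed
  also have "card (upair x ` S) = card S"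
    by (intro card_image inj_onI) (auto simp: upair_eq_iff)
  also have "card (\<Union>y\<in>S. tree_edges (f y) y) = (\<Sum>y\<in>S. card (tree_edges (f y) y))"
  proof (intro card_UN_disjoint ballI impI)
    fix y y' assume y: "y \<in> S" "y' \<in> S" "y \<noteq> y'"
    show "tree_edges (f y) y \<inter> tree_edges (f y') y' = {}"
      using te[OF y(1)] te[OF y(2)] disj[OF y] by fastforce
  qed (use finS ft in auto)
  finally have ce: "card (tree_edges t x) = card S + (\<Sum>y\<in>S. card (tree_edges (f y) y))" .
  have "tree_weight q p (f y) = q ^ card (inner_verts (f y) y) * p ^ card (tree_edges (f y) y)" if "y \<in> S" for y
    using that t pr(2) by (intro Suc.IH) auto
  then have "(\<Prod>y\<in>S. tree_weight q p (f y)) = q ^ (\<Sum>y\<in>S. card (inner_verts (f y) y)) * p ^ (\<Sum>y\<in>S. card (tree_edges (f y) y))"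
    by (simp add: prod.distrib power_sum)
  then show ?case unfolding ci ce by (simp add: t(1) power_add)
qed simp

lemma tree_edges_explore:
  "z \<in> tree_edges (explore (sym_adj n e) k x w) x \<Longrightarrow> e z"
proof (induction k arbitrary: x w)
  case (Suc k)
  then show ?case by (auto simp: nbrs_def sym_adj_iff split: if_splits)
qed simp

text \<open>The neighbours of an inner vertex have all been explored, except for the parent
  \<open>w\<close> of the root. Read contrapositively, this supplies the non-edges in the
  probability of an explored tree.\<close>

lemma inner_verts_explore:
  "a \<in> inner_verts (explore G k x w) x \<Longrightarrow> G a b \<Longrightarrow> b \<in> insert w (verts (explore G k x w) x)"
proof (induction k arbitrary: x w)
  case (Suc k)
  let ?S = "nbrs G x - {w}"
  show ?case
  proof (cases "a = x")
    case True
    then have "b \<in> ?S \<or> b = w" using Suc.prems by (auto simp: nbrs_def)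
    moreover have "b \<in> verts (explore G (Suc k) x w) x" if "b \<in> ?S"
    proof -
      have "b \<in> (\<Union>y\<in>?S. verts ((\<lambda>y\<in>?S. explore G k y x) y) y)" using that by (rule UN_I) simp
      then show ?thesis by simp
    qed
    ultimately show ?thesis by blast
  next
    case False
    then obtain y where y: "y \<in> ?S" "a \<in> inner_verts (explore G k y x) y" using Suc.prems(1) by auto
    then have "b \<in> insert x (verts (explore G k y x) y)" using Suc.IH Suc.prems(2) by blast
    then show ?thesis using y(1) by auto
  qed
qed simp

context corr_model
begin

text \<open>Only the pairs joining an inner vertex to a vertex outside \<open>R\<close> are used as non-edges, so that no pair
  is constrained in both graphs and the two trees contribute independent factors.\<close>

lemma tree_event_prob:
  assumes t: "t \<in> trees {1..n} k" "proper t x" and t': "t' \<in> trees {1..n} k" "proper t' x'"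
    and x: "x \<in> {1..n}" "x' \<in> {1..n}"
    and disj: "verts t x \<inter> verts t' x' = {}"
    and R: "card (verts t x \<union> verts t' x' \<union> {w, w'}) \<le> r" and q: "(1 - p) ^ (n - r) \<le> q"
  shows "measure_pmf.prob entries_pmf {X. explore (G1 X) k x w = t \<and> explore (G2 X) k x' w' = t'} \<le> tree_weight q p t * tree_weight q p t'"
proof -
  \<comment> \<open>The parents \<open>w\<close>, \<open>w'\<close> belong to \<open>R\<close>
    because exploration skips the edges to them and leaves these undecided. Each inner vertex is
    then a non-neighbour of every vertex outside \<open>R\<close>.\<close>
  define R where "R = verts t x \<union> verts t' x' \<union> {w, w'}"
  define Z where "Z = (\<lambda>t x. (\<lambda>(a, b). upair a b) ` (inner_verts t x \<times> ({1..n} - R)))"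
  have v: "verts t x \<subseteq> {1..n}" "verts t' x' \<subseteq> {1..n}"
    using verts_trees[of "{1..n}"] t t' x by auto
  have i: "inner_verts t x \<subseteq> verts t x" "inner_verts t' x' \<subseteq> verts t' x'" using inner_verts_subset_verts by auto
  have e: "tree_edges t x \<subseteq> {(a, b). a \<in> verts t x \<and> b \<in> verts t x \<and> a < b}"
    "tree_edges t' x' \<subseteq> {(a, b). a \<in> verts t' x' \<and> b \<in> verts t' x' \<and> a < b}"
    using tree_edges_subset t t' by auto
  have vR: "verts t x \<subseteq> R" "verts t' x' \<subseteq> R" by (auto simp: R_def)
  have finR: "finite R" unfolding R_def using v finite_subset by auto
  have Zd: "\<exists>a b. z = upair a b \<and> a \<in> inner_verts t x \<and> b \<in> {1..n} \<and> b \<notin> R" if "z \<in> Z t x" for z t x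
    using that unfolding Z_def by (elim imageE SigmaE) auto
  have ends: "(fst z = a \<and> snd z = b) \<or> (fst z = b \<and> snd z = a)" if "z = upair a b" for z a b
    using that by (auto simp: upair_def min_def max_def)
  have Zcard: "card (Z t x) = card (inner_verts t x) * card ({1..n} - R)" if "inner_verts t x \<subseteq> R" for t x
  proof -
    have "inj_on (\<lambda>(a, b). upair a b) (inner_verts t x \<times> ({1..n} - R))"
      using that by (intro inj_onI) (auto simp: upair_eq_iff)
    then show ?thesis by (simp add: Z_def card_image card_cartesian_product)
  qed
  have "card {1..n} - card R \<le> card ({1..n} - R)" using finR by (rule diff_card_le_card_Diff)
  then have "n - r \<le> card ({1..n} - R)" using R unfolding R_def[symmetric] by simp
  then have "(1 - p) ^ card ({1..n} - R) \<le> (1 - p) ^ (n - r)"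
    using p_bounds by (intro power_decreasing) auto
  then have q': "(1 - p) ^ card ({1..n} - R) \<le> q" using q by simp
  have "measure_pmf.prob entries_pmf {X. explore (G1 X) k x w = t \<and> explore (G2 X) k x' w' = t'} \<le>
    measure_pmf.prob entries_pmf {X. (\<forall>e\<in>tree_edges t x. fst (X e)) \<and> (\<forall>e\<in>tree_edges t' x'. snd (X e)) \<and>
      (\<forall>e\<in>Z t x. \<not> fst (X e)) \<and> (\<forall>e\<in>Z t' x'. \<not> snd (X e))}"
  proof (intro measure_pmf.finite_measure_mono subsetI CollectI conjI ballI)
    fix X assume "X \<in> {X. explore (G1 X) k x w = t \<and> explore (G2 X) k x' w' = t'}"
    then have X: "explore (G1 X) k x w = t" "explore (G2 X) k x' w' = t'" by auto
    show "fst (X z)" if "z \<in> tree_edges t x" for z using that tree_edges_explore[of z n "fst \<circ> X" k x w] X by simp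
    show "snd (X z)" if "z \<in> tree_edges t' x'" for z using that tree_edges_explore[of z n "snd \<circ> X" k x' w'] X by simp
    show "\<not> fst (X z)" if z: "z \<in> Z t x" for z
    proof
      assume *: "fst (X z)"
      obtain a b where ab: "z = upair a b" "a \<in> inner_verts t x" "b \<in> {1..n}" "b \<notin> R" using Zd[OF z] by blast
      then have "G1 X a b" using * v i vR by (auto simp: sym_adj_iff)
      then have "b \<in> R" using inner_verts_explore[of a "G1 X" k x w b] ab(2) X(1) by (auto simp: R_def)
      then show False using ab by simp
    qed
    show "\<not> snd (X z)" if z: "z \<in> Z t' x'" for z
    proof
      assume *: "snd (X z)"
      obtain a b where ab: "z = upair a b" "a \<in> inner_verts t' x'" "b \<in> {1..n}" "b \<notin> R" using Zd[OF z] by blast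
      then have "G2 X a b" using * v i vR by (auto simp: sym_adj_iff)
      then have "b \<in> R" using inner_verts_explore[of a "G2 X" k x' w' b] ab(2) X(2) by (auto simp: R_def)
      then show False using ab by simp
    qed
  qed auto
  also have "\<dots> \<le> p ^ (card (tree_edges t x) + card (tree_edges t' x')) * (1 - p) ^ (card (Z t x) + card (Z t' x'))"
  proof (rule cylinder_prob)
    show "tree_edges t x \<subseteq> upairs n" "tree_edges t' x' \<subseteq> upairs n"
      using e v by (fastforce simp: upairs_def)+
    show "Z t x \<subseteq> upairs n" "Z t' x' \<subseteq> upairs n"
    proof -
      have "z \<in> upairs n" if z: "z \<in> Z t x \<or> z \<in> Z t' x'" for z
      proof -
        obtain a b where ab: "z = upair a b" "a \<in> inner_verts t x \<or> a \<in> inner_verts t' x'" "b \<in> {1..n}" "b \<notin> R"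
          using z
        proof
          assume "z \<in> Z t x"
          from Zd[OF this] show ?thesis using that by blast
        next
          assume "z \<in> Z t' x'"
          from Zd[OF this] show ?thesis using that by blast
        qed
        then have "a \<in> {1..n}" "a \<noteq> b" using i v vR by auto
        then show ?thesis unfolding ab(1) using ab(3) by (intro upair_in_upairs)
      qed
      then show "Z t x \<subseteq> upairs n" "Z t' x' \<subseteq> upairs n" by auto
    qed
    show "tree_edges t x \<inter> tree_edges t' x' = {}" using e disj by fastforce
    have out: "fst z \<notin> R \<or> snd z \<notin> R" if z: "z \<in> Z t x" for z t x
    proof -
      obtain a b where "z = upair a b" "b \<notin> R" using Zd[OF z] by blast
      then show ?thesis using ends[of z a b] by auto
    qed
    have inn: "fst z \<in> R \<and> snd z \<in> R" if "z \<in> tree_edges t x \<or> z \<in> tree_edges t' x'" for z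
      using that e vR by (cases z) auto
    show "tree_edges t x \<inter> Z t x = {}" "tree_edges t x \<inter> Z t' x' = {}" "tree_edges t' x' \<inter> Z t x = {}"
      "tree_edges t' x' \<inter> Z t' x' = {}"
      using out inn by blast+
    \<comment> \<open>A pair in both sets has exactly one end in \<open>R\<close>, which would be an
      inner vertex of both trees; the trees are disjoint.\<close>
    show "Z t x \<inter> Z t' x' = {}"
    proof (rule ccontr)
      assume "Z t x \<inter> Z t' x' \<noteq> {}"
      then obtain z where "z \<in> Z t x" "z \<in> Z t' x'" by auto
      then obtain a b a' b' where "upair a b = upair a' b'" "a \<in> inner_verts t x" "b \<notin> R" "a' \<in> inner_verts t' x'" "b' \<notin> R"
        using Zd by metis
      moreover from this have "a \<in> R" "a' \<in> R" "a \<noteq> a'" using i vR disj by auto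
      ultimately show False unfolding upair_eq_iff by auto
    qed
  qed
  also have "\<dots> = p ^ card (tree_edges t x) * p ^ card (tree_edges t' x') *
      (((1 - p) ^ card ({1..n} - R)) ^ card (inner_verts t x) * ((1 - p) ^ card ({1..n} - R)) ^ card (inner_verts t' x'))"
    using Zcard i vR by (simp add: power_add mult.commute flip: power_mult)
  also have "\<dots> \<le> p ^ card (tree_edges t x) * p ^ card (tree_edges t' x') * (q ^ card (inner_verts t x) * q ^ card (inner_verts t' x'))"
  proof -
    have "0 \<le> (1 - p) ^ card ({1..n} - R)" using p_bounds by simp
    moreover from this q' have "0 \<le> q" by (rule order_trans)
    ultimately show ?thesis using q' p_bounds by (intro mult_left_mono mult_mono power_mono) auto
  qed
  also have "\<dots> = tree_weight q p t * tree_weight q p t'"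
    using tree_weight_eq[OF _ t(1) x(1) t(2)] tree_weight_eq[OF _ t'(1) x(2) t'(2)] by simp
  finally show ?thesis .
qed

text \<open>Markov's inequality is applied tree by tree: on the selected pairs the message divided
  by \<open>b\<close> is at least 1 and may be inserted as a factor, after which the sum is extended
  to all pairs of trees. The bound on \<open>r\<close> accounts for two trees of at most
  \<open>m\<close> vertices and the parents of their roots.\<close>

lemma message_prob:
  assumes x: "x \<in> {1..n}" "x' \<in> {1..n}" and "0 < b" and q: "(1 - p) ^ (n - r) \<le> q" and r: "2 * m + 2 \<le> r"
  shows "measure_pmf.prob entries_pmf {X. \<exists>t t'. t = explore (G1 X) k x w \<and> t' = explore (G2 X) k x' w' \<and>
      proper t x \<and> proper t' x' \<and> verts t x \<inter> verts t' x' = {} \<and>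
      card (verts t x) \<le> m \<and> card (verts t' x') \<le> m \<and> b < tree_msg lam s t t'} \<le>
    msg_sum {1..n} q p lam s k / b"
proof -
  let ?T = "trees {1..n} k"
  define good where "good = {(t, t') \<in> ?T \<times> ?T. proper t x \<and> proper t' x' \<and> verts t x \<inter> verts t' x' = {} \<and>
      card (verts t x) \<le> m \<and> card (verts t' x') \<le> m \<and> b < tree_msg lam s t t'}"
  define E where "E = (\<lambda>(t, t'). {X. explore (G1 X) k x w = t \<and> explore (G2 X) k x' w' = t'})"
  have finT: "finite ?T" by (simp add: finite_trees)
  have fin: "finite good"
    by (rule finite_subset[OF _ finite_cartesian_product[OF finT finT]]) (auto simp: good_def)
  have q0: "0 \<le> q" using q p_bounds zero_le_power[of "1 - p" "n - r"] by linarith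
  have inT: "explore (sym_adj n e) k y z \<in> ?T" for e y z
    by (intro explore_in_trees nbrs_sym_adj)
  have "measure_pmf.prob entries_pmf {X. \<exists>t t'. t = explore (G1 X) k x w \<and> t' = explore (G2 X) k x' w' \<and>
      proper t x \<and> proper t' x' \<and> verts t x \<inter> verts t' x' = {} \<and>
      card (verts t x) \<le> m \<and> card (verts t' x') \<le> m \<and> b < tree_msg lam s t t'} \<le> measure_pmf.prob entries_pmf (\<Union>\<tau>\<in>good. E \<tau>)"
    using inT by (intro measure_pmf.finite_measure_mono) (auto simp: good_def E_def)
  also have "\<dots> \<le> (\<Sum>\<tau>\<in>good. measure_pmf.prob entries_pmf (E \<tau>))"
    using fin by (intro measure_pmf.finite_measure_subadditive_finite) auto
  also have "\<dots> \<le> (\<Sum>(t, t')\<in>good. tree_weight q p t * tree_weight q p t' * tree_msg lam s t t' / b)"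
  proof (rule sum_mono, clarify)
    fix t t' assume g: "(t, t') \<in> good"
    have w0: "0 \<le> tree_weight q p t * tree_weight q p t'" using q0 p_bounds by (simp add: tree_weight_nonneg)
    have "card (verts t x \<union> verts t' x' \<union> {w, w'}) \<le> card (verts t x) + card (verts t' x') + card {w, w'}"
      by (meson add_le_mono1 card_Un_le le_trans)
    also have "\<dots> \<le> r" using g r card_insert_le_m1[of 2 "{w'}" w] by (auto simp: good_def)
    finally have c: "card (verts t x \<union> verts t' x' \<union> {w, w'}) \<le> r" .
    have "measure_pmf.prob entries_pmf (E (t, t')) \<le> tree_weight q p t * tree_weight q p t'"
    proof -
      have "t \<in> ?T" "t' \<in> ?T" "proper t x" "proper t' x'" "verts t x \<inter> verts t' x' = {}"
        using g by (auto simp: good_def)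
      from tree_event_prob[OF this(1,3,2,4) x this(5) c q] show ?thesis by (simp add: E_def)
    qed
    also have "\<dots> \<le> tree_weight q p t * tree_weight q p t' * (tree_msg lam s t t' / b)"
      using g \<open>0 < b\<close> mult_left_mono[OF _ w0, of 1 "tree_msg lam s t t' / b"] by (auto simp: good_def)
    finally show "measure_pmf.prob entries_pmf (E (t, t')) \<le> tree_weight q p t * tree_weight q p t' * tree_msg lam s t t' / b" by simp
  qed
  also have "\<dots> \<le> (\<Sum>(t, t')\<in>?T \<times> ?T. tree_weight q p t * tree_weight q p t' * tree_msg lam s t t' / b)"
    using finT q0 p_bounds lam s \<open>0 < b\<close>
    by (intro sum_mono2) (auto simp: good_def intro!: divide_nonneg_nonneg mult_nonneg_nonneg tree_weight_nonneg tree_msg_nonneg)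
  also have "\<dots> = msg_sum {1..n} q p lam s k / b"
    by (simp add: msg_sum_def sum.cartesian_product sum_divide_distrib case_prod_unfold)
  finally show ?thesis .
qed

end

section \<open>Mismatched vertices\<close>

lemma explore_verts_ball:
  assumes "symp G" "irreflp G" "ball_acyclic G i d" "ancestral G i r w x" "length r + k \<le> Suc d"
  shows "verts (explore G k x w) x \<subseteq> ball_graph G i d"
proof
  fix z assume "z \<in> verts (explore G k x w) x"
  from explore_path[OF assms this] obtain q where q: "successively G (r @ q)" "last (r @ q) = z" "length q \<le> k"
    by blast
  have r: "r \<noteq> []" "hd r = i" using assms(4) by (auto simp: ancestral_def)
  then have "set (r @ q) \<subseteq> ball_graph G i d" using path_in_ball[OF q(1), of d] q(3) assms(5) by auto
  moreover have "z \<in> set (r @ q)" using q(2) r(1) last_in_set[of "r @ q"] by simp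
  ultimately show "z \<in> ball_graph G i d" by blast
qed

lemma MPAlign_relabel:
  assumes f: "bij f" and fV: "\<And>u. u \<in> {1..n} \<Longrightarrow> f u \<in> {1..n}"
    and iu: "(i, u) \<in> MPAlign lam s n G (\<lambda>u v. H (f u) (f v)) d b"
  shows "(i, f u) \<in> MPAlign lam s n G H d b"
proof -
  let ?H = "\<lambda>u v. H (f u) (f v)"
  from iu obtain j v where jv: "inj_on j {1..3}" "inj_on v {1..3}"
    "\<forall>t\<in>{1..3::nat}. j t \<in> nbrs G i \<and> v t \<in> nbrs ?H u \<and> msg lam s G ?H (d - 1) (j t) i (v t) u > b"
    and h: "i \<in> {1..n}" "u \<in> {1..n}" "ball_acyclic G i d" "ball_acyclic ?H u d"
    unfolding MPAlign_def by blast
  have "inj_on (f \<circ> v) {1..3}"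
    using jv(2) f by (intro comp_inj_on) (auto simp: bij_def intro: inj_on_subset)
  moreover have "\<forall>t\<in>{1..3::nat}. j t \<in> nbrs G i \<and> (f \<circ> v) t \<in> nbrs H (f u) \<and>
      msg lam s G H (d - 1) (j t) i ((f \<circ> v) t) (f u) > b"
  proof
    fix t :: nat assume "t \<in> {1..3}"
    then have t: "j t \<in> nbrs G i \<and> v t \<in> nbrs ?H u \<and> msg lam s G ?H (d - 1) (j t) i (v t) u > b"
      using jv(3) by blast
    then show "j t \<in> nbrs G i \<and> (f \<circ> v) t \<in> nbrs H (f u) \<and>
      msg lam s G H (d - 1) (j t) i ((f \<circ> v) t) (f u) > b"
      unfolding msg_relabel[OF f] by (auto simp: nbrs_def)
  qed
  ultimately show ?thesis
    unfolding MPAlign_def using jv(1) h fV ball_acyclic_relabel[OF f h(4)] by blast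
qed

text \<open>In aligned labels the true partner of \<open>i\<close> is \<open>i\<close> itself, so
  these are the wrongly matched vertices with the planted permutation removed.\<close>

definition mismatched :: "real \<Rightarrow> real \<Rightarrow> nat \<Rightarrow> graph \<Rightarrow> graph \<Rightarrow> nat \<Rightarrow> real \<Rightarrow> nat set" where
  "mismatched lam s n G H d b = {i\<in>{1..n}. \<exists>u. u \<noteq> i \<and> (i, u) \<in> MPAlign lam s n G H d b}"

text \<open>The bound holds pointwise for each permutation: relabelling by its inverse sends a
  partner other than \<open>\<sigma> i\<close> to a vertex other than \<open>i\<close>.
  Probabilities need then be estimated only for the aligned pair.\<close>

lemma err_le_mismatched:
  assumes "\<sigma> permutes {1..n}"
  shows "\<bar>err lam s n d b (X, \<sigma>)\<bar> \<le>
    real (card (mismatched lam s n (sym_adj n (fst \<circ> X)) (sym_adj n (snd \<circ> X)) d b)) / real n"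
proof -
  let ?G = "sym_adj n (fst \<circ> X)" and ?H = "sym_adj n (snd \<circ> X)" and ?f = "inv \<sigma>"
  let ?P = "\<lambda>i. \<exists>u. u \<noteq> \<sigma> i \<and> (i, u) \<in> MPAlign lam s n ?G (\<lambda>u v. ?H (?f u) (?f v)) d b"
  have f: "bij ?f" using assms by (simp add: permutes_bij bij_imp_bij_inv)
  have fV: "?f u \<in> {1..n}" if "u \<in> {1..n}" for u
    using that permutes_in_image[OF permutes_inv[OF assms]] by blast
  have "i \<in> mismatched lam s n ?G ?H d b" if i: "i \<in> {1..n}" "?P i" for i
  proof -
    obtain u where u: "u \<noteq> \<sigma> i" "(i, u) \<in> MPAlign lam s n ?G (\<lambda>u v. ?H (?f u) (?f v)) d b"
      using i(2) by blast
    have "?f u \<noteq> i" using u(1) permutes_inverses(1)[OF assms] by metis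
    then show ?thesis using MPAlign_relabel[OF f fV u(2)] i(1) unfolding mismatched_def by blast
  qed
  then have "card {i\<in>{1..n}. ?P i} \<le> card (mismatched lam s n ?G ?H d b)"
    by (intro card_mono) (auto simp: mismatched_def)
  moreover have "err lam s n d b (X, \<sigma>) = 1 / real n * (\<Sum>i = 1..n. of_bool (?P i))"
    by (simp add: err_def graph1_def graph2_def[abs_def] graph2_aligned_def planted_def)
  moreover have "(\<Sum>i = 1..n. of_bool (?P i) :: real) = real (card {i\<in>{1..n}. ?P i})"
    by (simp add: of_bool_def sum.If_cases Int_def)
  ultimately show ?thesis by (simp add: divide_right_mono)
qed

context corr_model
begin

text \<open>The size bounds and disjointness are part of the event, so that it can be estimated
  without conditioning on the shape of the balls. The vertices \<open>w\<close>, \<open>w'\<close>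
  are the parents of the roots \<open>x\<close>, \<open>x'\<close>.\<close>

definition msg_event :: "nat \<Rightarrow> nat \<Rightarrow> real \<Rightarrow> nat \<times> nat \<times> nat \<times> nat \<Rightarrow> (nat \<times> nat \<Rightarrow> bool \<times> bool) set" where
  "msg_event k m b = (\<lambda>(x, w, x', w'). {X. \<exists>t t'. t = explore (G1 X) k x w \<and> t' = explore (G2 X) k x' w' \<and>
      proper t x \<and> proper t' x' \<and> verts t x \<inter> verts t' x' = {} \<and>
      card (verts t x) \<le> m \<and> card (verts t' x') \<le> m \<and> b < tree_msg lam s t t'})"

text \<open>This is the deterministic half. In acyclic balls the explored trees are proper and
  small, so a message above \<open>b\<close> between disjoint trees is excluded by
  \<open>no_msg\<close>; all three pairs of trees must meet.\<close>

lemma mismatched_chorded: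
  assumes small: "\<And>x. x \<in> {1..n} \<Longrightarrow> card (ball_graph (G1 X) x (Suc k)) \<le> m"
      "\<And>x. x \<in> {1..n} \<Longrightarrow> card (ball_graph (G2 X) x (Suc k)) \<le> m"
    and no_msg: "\<And>\<kappa>. \<kappa> \<in> {1..n} \<times> {1..n} \<times> {1..n} \<times> {1..n} \<Longrightarrow> X \<notin> msg_event k m b \<kappa>"
    and i: "i \<in> mismatched lam s n (G1 X) (G2 X) (Suc k) b"
  shows "chorded (G1 X) (G2 X) (Suc k) i"
proof -
  let ?G = "G1 X" and ?H = "G2 X"
  obtain i' j v where h: "i' \<noteq> i" "i \<in> {1..n}" "i' \<in> {1..n}" "ball_acyclic ?G i (Suc k)" "ball_acyclic ?H i' (Suc k)"
    "inj_on j {1..3::nat}" "inj_on v {1..3::nat}"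
    "\<forall>t\<in>{1..3::nat}. j t \<in> nbrs ?G i \<and> v t \<in> nbrs ?H i' \<and> msg lam s ?G ?H k (j t) i (v t) i' > b"
    using i unfolding mismatched_def MPAlign_def by auto
  note GG = symp_sym_adj irreflp_sym_adj
  have sub: "proper (explore R k y c) y \<and> verts (explore R k y c) y \<subseteq> ball_graph R c (Suc k)"
    if R: "R = sym_adj n e" "ball_acyclic R c (Suc k)" "y \<in> nbrs R c" for R e c y
  proof -
    have GR: "symp R" "irreflp R" using GG R(1) by auto
    have "ancestral R c [c] c c" by (simp add: ancestral_def)
    then have anc: "ancestral R c [c, y] c y"
      using ancestral_child[OF GR R(2), of "[c]" c c y] R(3) GR(2) by (auto simp: nbrs_def irreflp_def)
    show ?thesis
      using explore_proper[OF GR R(2) anc, of k] explore_verts_ball[OF GR R(2) anc, of k] by simp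
  qed
  have meet: "verts (explore ?G k (j t) i) (j t) \<inter> verts (explore ?H k (v t) i') (v t) \<noteq> {}" if t: "t \<in> {1..3}" for t
  proof
    assume disj: "verts (explore ?G k (j t) i) (j t) \<inter> verts (explore ?H k (v t) i') (v t) = {}"
    have jt: "j t \<in> nbrs ?G i" and vt: "v t \<in> nbrs ?H i'" and mt: "msg lam s ?G ?H k (j t) i (v t) i' > b"
      using h(8) t by auto
    have "j t \<in> {1..n}" "v t \<in> {1..n}" using jt vt nbrs_sym_adj by blast+
    moreover have "i \<in> nbrs ?G (j t)" "i' \<in> nbrs ?H (v t)"
      using jt vt GG(1) by (auto simp: nbrs_def symp_def)
    then have "tree_msg lam s (explore ?G k (j t) i) (explore ?H k (v t) i') > b"
      using mt by (subst msg_eq_tree_msg[symmetric, OF GG(1) GG(1)]) (auto intro: finite_subset[OF nbrs_sym_adj])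
    moreover have P: "proper (explore ?G k (j t) i) (j t)" "proper (explore ?H k (v t) i') (v t)"
      and V: "verts (explore ?G k (j t) i) (j t) \<subseteq> ball_graph ?G i (Suc k)"
      "verts (explore ?H k (v t) i') (v t) \<subseteq> ball_graph ?H i' (Suc k)"
      using sub[OF refl h(4) jt] sub[OF refl h(5) vt] by auto
    moreover have "card (verts (explore ?G k (j t) i) (j t)) \<le> m"
      using small(1)[OF h(2)] card_mono[OF _ V(1)] finite_subset[OF ball_sym_adj_subset[OF h(2)]]
      by (meson finite_atLeastAtMost order_trans)
    moreover have "card (verts (explore ?H k (v t) i') (v t)) \<le> m"
      using small(2)[OF h(3)] card_mono[OF _ V(2)] finite_subset[OF ball_sym_adj_subset[OF h(3)]]
      by (meson finite_atLeastAtMost order_trans)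
    ultimately have "X \<in> msg_event k m b (j t, i, v t, i')" using disj unfolding msg_event_def by blast
    moreover have "(j t, i, v t, i') \<in> {1..n} \<times> {1..n} \<times> {1..n} \<times> {1..n}"
      using \<open>j t \<in> {1..n}\<close> \<open>v t \<in> {1..n}\<close> h by blast
    ultimately show False using no_msg by blast
  qed
  have "\<exists>A B. distinct A \<and> distinct B \<and> A \<noteq> [] \<and> B \<noteq> [] \<and> hd A = hd B \<and> last A = last B \<and> A \<noteq> B \<and>
    successively ?G A \<and> successively ?H B \<and> i \<in> set A \<and>
    length A \<le> 2 * Suc k + 1 \<and> length B \<le> 2 * Suc k + 1"
    using meeting_spiders[OF GG h(4) GG h(5) _ h(6) _ h(7) _ meet] h(1,8) by blast
  then show ?thesis using two_paths_chorded by blast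
qed

text \<open>The three summands stand for chords, large balls in either graph, and large messages
  between disjoint trees. The quantity \<open>\<delta>\<close> is \<open>p\<close> times the
  \<open>2 * \<mu> + 2\<close> vertices set aside when non-edges are counted:
  \<open>(1 - p) ^ (n - (2 * m + 2))\<close> is at most \<open>exp (\<delta> - lam)\<close>. The
  smallness conditions keep the mean message below 2.\<close>

lemma mismatched_prob:
  assumes "0 < r" "0 < \<mu>" "0 < b" and \<delta>: "\<delta> = lam * (2 * \<mu> + 2) / real n" and "1 < \<rho>"
    and small: "\<delta> * \<rho> * real k * (lam * \<rho>) ^ k \<le> 1 / 2" "\<delta> * \<rho> * real k * (lam * \<rho>) ^ k \<le> (\<rho> - 1) / 2"
  shows "measure_pmf.prob entries_pmf {X. r \<le> real (card (mismatched lam s n (G1 X) (G2 X) (Suc k) b))} \<le>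
    (2 * real (Suc k) + 1) ^ 5 * lam ^ (4 * Suc k) / r +
    2 * (real n * (2 * real (Suc k) + 1) * lam ^ (2 * Suc k) / \<mu>\<^sup>2) + real n ^ 4 * (2 / b)"
proof -
  let ?P = "measure_pmf.prob entries_pmf"
  define m where "m = nat \<lfloor>\<mu>\<rfloor>"
  define q where "q = exp (\<delta> - lam)"
  let ?I = "{1..n} \<times> {1..n} \<times> {1..n} \<times> {1..n}"
  let ?C = "{X. r \<le> real (card {i\<in>{1..n}. chorded (G1 X) (G2 X) (Suc k) i})}"
  let ?S1 = "{X. \<exists>x\<in>{1..n}. \<mu> < real (card (ball_graph (G1 X) x (Suc k)))}"
  let ?S2 = "{X. \<exists>x\<in>{1..n}. \<mu> < real (card (ball_graph (G2 X) x (Suc k)))}"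
  let ?M = "\<Union>\<kappa>\<in>?I. msg_event k m b \<kappa>"
  have m: "real m \<le> \<mu>" using assms(2) by (simp add: m_def)
  have "{X. r \<le> real (card (mismatched lam s n (G1 X) (G2 X) (Suc k) b))} \<subseteq> ?C \<union> (?S1 \<union> ?S2) \<union> ?M"
  proof
    fix X assume X: "X \<in> {X. r \<le> real (card (mismatched lam s n (G1 X) (G2 X) (Suc k) b))}"
    show "X \<in> ?C \<union> (?S1 \<union> ?S2) \<union> ?M"
    proof (rule ccontr)
      assume N: "X \<notin> ?C \<union> (?S1 \<union> ?S2) \<union> ?M"
      have le: "c \<le> m" if "\<not> \<mu> < real c" for c
        using that unfolding m_def by (simp add: le_nat_floor)
      have small: "card (ball_graph (G1 X) x (Suc k)) \<le> m" "card (ball_graph (G2 X) x (Suc k)) \<le> m"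
        if "x \<in> {1..n}" for x
        using N that by (auto intro!: le)
      have no_msg: "X \<notin> msg_event k m b \<kappa>" if "\<kappa> \<in> ?I" for \<kappa> using N that by blast
      have "chorded (G1 X) (G2 X) (Suc k) i" if "i \<in> mismatched lam s n (G1 X) (G2 X) (Suc k) b" for i
        using small no_msg that by (rule mismatched_chorded)
      then have "mismatched lam s n (G1 X) (G2 X) (Suc k) b \<subseteq> {i\<in>{1..n}. chorded (G1 X) (G2 X) (Suc k) i}"
        unfolding mismatched_def by blast
      then have "card (mismatched lam s n (G1 X) (G2 X) (Suc k) b) \<le> card {i\<in>{1..n}. chorded (G1 X) (G2 X) (Suc k) i}"
        by (intro card_mono) auto
      then show False using X N by auto
    qed
  qed
  then have "?P {X. r \<le> real (card (mismatched lam s n (G1 X) (G2 X) (Suc k) b))} \<le> ?P (?C \<union> (?S1 \<union> ?S2) \<union> ?M)"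
    by (intro measure_pmf.finite_measure_mono) auto
  also have "\<dots> \<le> ?P ?C + (?P ?S1 + ?P ?S2) + ?P ?M"
    by (intro order_trans[OF measure_Un_le] add_mono order_refl) auto
  also have "\<dots> \<le> (2 * real (Suc k) + 1) ^ 5 * lam ^ (4 * Suc k) / r +
      (real n * (2 * real (Suc k) + 1) * lam ^ (2 * Suc k) / \<mu>\<^sup>2 +
       real n * (2 * real (Suc k) + 1) * lam ^ (2 * Suc k) / \<mu>\<^sup>2) + real n ^ 4 * (2 / b)"
  proof (intro add_mono chord_prob ball_size_prob assms(1,2))
    have q: "(1 - p) ^ (n - (2 * m + 2)) \<le> q"
    proof -
      have "(1 - p) ^ (n - (2 * m + 2)) \<le> exp (- p) ^ (n - (2 * m + 2))"
        using p_bounds exp_ge_add_one_self[of "- p"] by (intro power_mono) auto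
      also have "\<dots> = exp (- (real (n - (2 * m + 2)) * p))" by (simp add: exp_of_nat_mult[symmetric])
      also have "\<dots> \<le> q"
      proof -
        have "(real n - (2 * \<mu> + 2)) * p \<le> real (n - (2 * m + 2)) * p"
          using m p_bounds by (intro mult_right_mono) auto
        moreover have "(real n - (2 * \<mu> + 2)) * p = lam - \<delta>"
          using p_bounds(3) n_pos by (simp add: \<delta> p_def field_simps)
        ultimately show ?thesis unfolding q_def by simp
      qed
      finally show ?thesis .
    qed
    have "msg_sum {1..n} q p lam s k \<le> 1 + 2 * (\<delta> * \<rho> * real k * (lam * \<rho>) ^ k)"
      using sums_bounded[of "{1..n}" p s lam q \<delta> \<rho> k k] p_bounds s lam assms(2,5) small q_def \<delta> by simp
    also have "\<dots> \<le> 2" using small(1) by simp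
    finally have F: "msg_sum {1..n} q p lam s k \<le> 2" .
    have "?P ?M \<le> (\<Sum>\<kappa>\<in>?I. ?P (msg_event k m b \<kappa>))"
      by (intro measure_pmf.finite_measure_subadditive_finite) auto
    also have "\<dots> \<le> (\<Sum>\<kappa>\<in>?I. 2 / b)"
    proof (rule sum_mono)
      fix \<kappa> assume "\<kappa> \<in> ?I"
      then obtain x w x' w' where \<kappa>: "\<kappa> = (x, w, x', w')" "x \<in> {1..n}" "x' \<in> {1..n}" by blast
      have "?P (msg_event k m b \<kappa>) \<le> msg_sum {1..n} q p lam s k / b"
        using message_prob[OF \<kappa>(2,3) assms(3) q, of m k w w'] by (simp add: \<kappa> msg_event_def)
      also have "\<dots> \<le> 2 / b" using F assms(3) by (simp add: divide_right_mono)
      finally show "?P (msg_event k m b \<kappa>) \<le> 2 / b" .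
    qed
    also have "\<dots> = real n ^ 4 * (2 / b)"
      by (simp add: card_cartesian_product eval_nat_numeral)
    finally show "?P ?M \<le> real n ^ 4 * (2 / b)" .
  qed
  finally show ?thesis by (simp only: mult_2)
qed

lemma err_prob_le:
  assumes "0 < \<epsilon>"
  shows "measure_pmf.prob (corr_graphs n lam s) {\<omega>. \<bar>err lam s n d b \<omega>\<bar> > \<epsilon>} \<le>
    measure_pmf.prob entries_pmf {X. \<epsilon> * real n \<le> real (card (mismatched lam s n (G1 X) (G2 X) d b))}"
proof -
  let ?B = "{X. \<epsilon> * real n \<le> real (card (mismatched lam s n (G1 X) (G2 X) d b))}"
  have fin: "finite {\<sigma>. \<sigma> permutes {1..n}}" "{\<sigma>. \<sigma> permutes {1..n}} \<noteq> {}"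
    using finite_permutations[of "{1..n}"] permutes_id[of "{1..n}"] by blast+
  have eq: "corr_graphs n lam s = pair_pmf entries_pmf (pmf_of_set {\<sigma>. \<sigma> permutes {1..n}})"
    by (simp add: corr_graphs_def entries_pmf_def upairs_def)
  have "measure_pmf.prob (corr_graphs n lam s) {\<omega>. \<bar>err lam s n d b \<omega>\<bar> > \<epsilon>} \<le>
      measure_pmf.prob (corr_graphs n lam s) (fst -` ?B)"
  proof (rule measure_pmf.finite_measure_mono_AE)
    show "AE \<omega> in measure_pmf (corr_graphs n lam s).
      \<omega> \<in> {\<omega>. \<bar>err lam s n d b \<omega>\<bar> > \<epsilon>} \<longrightarrow> \<omega> \<in> fst -` ?B"
    proof (rule AE_pmfI, rule impI)
      fix \<omega> assume \<omega>: "\<omega> \<in> set_pmf (corr_graphs n lam s)" "\<omega> \<in> {\<omega>. \<bar>err lam s n d b \<omega>\<bar> > \<epsilon>}"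
      obtain X \<sigma> where X: "\<omega> = (X, \<sigma>)" by (cases \<omega>)
      then have "\<sigma> permutes {1..n}" using \<omega>(1) fin by (auto simp: eq)
      from err_le_mismatched[OF this, of lam s d b X] have
        "\<epsilon> < real (card (mismatched lam s n (G1 X) (G2 X) d b)) / real n" using \<omega>(2) X by simp
      then show "\<omega> \<in> fst -` ?B" using n_pos by (simp add: X field_simps)
    qed
  qed auto
  also have "\<dots> = measure_pmf.prob (map_pmf fst (corr_graphs n lam s)) ?B" by simp
  also have "\<dots> = measure_pmf.prob entries_pmf ?B" by (simp only: eq map_fst_pair_pmf)
  finally show ?thesis .
qed

end

section \<open>Choice of the parameters and passage to the limit\<close>

theorem theorem8:
  fixes lam s c \<gamma> :: real and d :: "nat \<Rightarrow> nat" and \<beta> :: "nat \<Rightarrow> real"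
  assumes "lam > 0" and "0 \<le> s" and "s \<le> 1"
    and "c > 0" and "c * ln lam < 1 / 4"
    and "0 < \<gamma>" and "\<gamma> < c * ln (lam * s)"
    and "\<And>n. d n = nat \<lfloor>c * ln (real n)\<rfloor>"
    and "\<And>n. \<beta> n = exp (real n powr \<gamma>)"
  shows "\<forall>\<epsilon>>0. (\<lambda>n. measure_pmf.prob (corr_graphs n lam s)
           {\<omega>. \<bar>err lam s n (d n) (\<beta> n) \<omega>\<bar> > \<epsilon>}) \<longlonglongrightarrow> 0"
proof (intro allI impI)
  fix \<epsilon> :: real assume \<epsilon>: "0 < \<epsilon>"
  \<comment> \<open>A positive \<open>\<gamma>\<close> below \<open>c * ln (lam * s)\<close> forces
    \<open>lam * s\<close> above 1, hence \<open>lam > 1\<close>.\<close>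
  have "0 < c * ln (lam * s)" using assms(6,7) by linarith
  then have "0 < ln (lam * s)" using assms(4) by (simp add: zero_less_mult_iff)
  then have "1 < lam * s" using assms(1,2) by (cases "lam * s = 0") (auto simp: ln_gt_zero_iff)
  moreover have "lam * s \<le> lam" using assms(1,3) by (simp add: mult_left_le)
  ultimately have lam1: "1 < lam" by linarith
  define a where "a = c * ln lam"
  \<comment> \<open>Chosen so that \<open>a' = c * ln (lam * \<rho>)\<close> is the midpoint of
    \<open>a\<close> and \<open>1 / 4\<close>: there is room for a growth rate slightly above
    \<open>lam\<close>.\<close>
  define \<rho> where "\<rho> = exp ((1 / 4 - a) / (2 * c))"
  define a' where "a' = c * ln (lam * \<rho>)"
  have a: "0 < a" "a < 1 / 4" using assms(4,5) lam1 by (auto simp: a_def)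
  have \<rho>: "1 < \<rho>" using a assms(4) by (simp add: \<rho>_def)
  have "a' = a + (1 / 4 - a) / 2"
    using lam1 \<rho> assms(4) by (simp add: a'_def a_def ln_mult \<rho>_def field_simps)
  then have "2 * a' = a + 1 / 4" by (simp add: field_simps)
  then have a': "0 < a'" "a' < 1 / 4" using a by linarith+
  \<comment> \<open>Messages are iterated \<open>d - 1\<close> times. The truncated subtraction is
    harmless since \<open>d n\<close> is eventually at least 1.\<close>
  define k where "k = (\<lambda>n. d n - 1)"
  define \<mu> where "\<mu> = (\<lambda>n. real n powr (3 / 4))"
  define \<delta> where "\<delta> = (\<lambda>n. lam * (2 * \<mu> n + 2) / real n)"
  have pow: "x ^ l \<le> real n powr (c * ln x)" if "1 \<le> x" "1 \<le> n" "real l \<le> c * ln (real n)" for x :: real and l n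
  proof -
    have "x ^ l = exp (real l * ln x)" using that by (simp add: exp_of_nat_mult)
    also have "\<dots> \<le> exp (c * ln (real n) * ln x)" using that by (simp add: mult_right_mono)
    finally show ?thesis using that by (simp add: powr_def mult_ac)
  qed
  have d: "real (d n) \<le> c * ln (real n)" if "1 \<le> n" for n
    using that assms(4) by (simp add: assms(8))
  have ev_n: "eventually (\<lambda>n. 1 \<le> n \<and> lam * (2 - s) \<le> real n) sequentially"
    using eventually_ge_at_top[of "max 1 (nat \<lceil>lam * (2 - s)\<rceil>)"]
    by eventually_elim (auto simp: nat_le_iff ceiling_le_iff)
  have "filterlim (\<lambda>n. c * ln (real n)) at_top sequentially" using assms(4) by real_asymp
  then have "eventually (\<lambda>n. 1 \<le> c * ln (real n)) sequentially" by (simp add: filterlim_at_top)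
  then have ev_d: "eventually (\<lambda>n. 1 \<le> d n) sequentially"
    by eventually_elim (simp add: assms(8) le_nat_iff le_floor_iff)
  \<comment> \<open>The cutoff over \<open>n\<close> has order \<open>n powr (- 1 / 4)\<close>,
    which beats the growth \<open>n powr a'\<close> and the logarithm because
    \<open>a' < 1 / 4\<close>.\<close>
  have "(\<lambda>n. (lam * (2 * real n powr (3 / 4) + 2) / real n) * \<rho> * (c * ln (real n)) * real n powr a') \<longlonglongrightarrow> 0"
    using a' by real_asymp
  then have "eventually (\<lambda>n. \<delta> n * \<rho> * (c * ln (real n)) * real n powr a' < min (1 / 2) ((\<rho> - 1) / 2)) sequentially"
    using \<rho> unfolding \<delta>_def \<mu>_def by (intro order_tendstoD) auto
  then have ev_small: "eventually (\<lambda>n. \<delta> n * \<rho> * real (k n) * (lam * \<rho>) ^ k n \<le> 1 / 2 \<and>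
      \<delta> n * \<rho> * real (k n) * (lam * \<rho>) ^ k n \<le> (\<rho> - 1) / 2) sequentially"
    using ev_n
  proof eventually_elim
    case (elim n)
    have "real (k n) \<le> c * ln (real n)" using d[of n] elim by (simp add: k_def)
    moreover from this have "(lam * \<rho>) ^ k n \<le> real n powr a'"
      unfolding a'_def using elim lam1 \<rho> mult_mono[of 1 lam 1 \<rho>] by (intro pow) auto
    moreover have "0 \<le> \<delta> n * \<rho>" "0 \<le> \<delta> n * \<rho> * (c * ln (real n))"
      using lam1 \<rho> assms(4) elim by (simp_all add: \<delta>_def \<mu>_def)
    ultimately have "\<delta> n * \<rho> * real (k n) * (lam * \<rho>) ^ k n \<le> \<delta> n * \<rho> * (c * ln (real n)) * real n powr a'"
      using lam1 \<rho> by (intro mult_mono[of "_ * real (k n)"] mult_left_mono) auto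
    then show ?case using elim by auto
  qed
  \<comment> \<open>Up to logarithms the first two terms are of order
    \<open>n powr (4 * a - 1)\<close> and \<open>n powr (2 * a - 1 / 2)\<close>. In the third, the
    exponential threshold outweighs the \<open>n ^ 4\<close> quadruples for every positive
    \<open>\<gamma>\<close>.\<close>
  define bound where "bound = (\<lambda>n. (2 * (c * ln (real n)) + 1) ^ 5 * real n powr (4 * a) / (\<epsilon> * real n) +
    2 * (real n * (2 * (c * ln (real n)) + 1) * real n powr (2 * a) / (real n powr (3 / 4))\<^sup>2) +
    real n ^ 4 * (2 / exp (real n powr \<gamma>)))"
  have lim: "bound \<longlonglongrightarrow> 0"
  proof -
    have l1: "(\<lambda>n. (2 * (c * ln (real n)) + 1) ^ 5 * real n powr (4 * a) / (\<epsilon> * real n)) \<longlonglongrightarrow> 0"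
      using a \<epsilon> assms(4) by real_asymp
    have l2: "(\<lambda>n. 2 * (real n * (2 * (c * ln (real n)) + 1) * real n powr (2 * a) / (real n powr (3 / 4))\<^sup>2)) \<longlonglongrightarrow> 0"
      using a assms(4) by real_asymp
    have l3: "(\<lambda>n. real n ^ 4 * (2 / exp (real n powr \<gamma>))) \<longlonglongrightarrow> 0"
      using assms(6) by real_asymp
    show ?thesis using tendsto_add[OF tendsto_add[OF l1 l2] l3] unfolding bound_def by simp
  qed
  have "eventually (\<lambda>n. measure_pmf.prob (corr_graphs n lam s)
      {\<omega>. \<bar>err lam s n (d n) (\<beta> n) \<omega>\<bar> > \<epsilon>} \<le> bound n) sequentially"
    using ev_n ev_d ev_small
  proof eventually_elim
    case (elim n)
    interpret corr_model n lam s by unfold_locales (use lam1 assms(2,3) elim in auto)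
    have dk: "d n = Suc (k n)" using elim by (simp add: k_def)
    have pos: "0 < \<epsilon> * real n" "0 < \<mu> n" "0 < \<beta> n"
      using \<epsilon> elim by (auto simp: \<mu>_def assms(9))
    have "measure_pmf.prob (corr_graphs n lam s) {\<omega>. \<bar>err lam s n (d n) (\<beta> n) \<omega>\<bar> > \<epsilon>} \<le>
      (2 * real (d n) + 1) ^ 5 * lam ^ (4 * d n) / (\<epsilon> * real n) +
      2 * (real n * (2 * real (d n) + 1) * lam ^ (2 * d n) / (\<mu> n)\<^sup>2) + real n ^ 4 * (2 / \<beta> n)"
      unfolding dk
      using err_prob_le[OF \<epsilon>, of "Suc (k n)" "\<beta> n"]
        mismatched_prob[OF pos \<delta>_def[THEN fun_cong, of n] \<rho>, of "k n"] elim by (auto intro: order_trans)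
    also have "\<dots> \<le> bound n"
      unfolding bound_def \<mu>_def assms(9)
    proof (intro add_mono mult_mono mult_left_mono divide_right_mono power_mono order_refl)
      have "lam ^ (4 * d n) = (lam ^ d n) ^ 4" "lam ^ (2 * d n) = (lam ^ d n) ^ 2"
        by (simp_all add: power_mult mult.commute flip: power_mult)
      moreover have "lam ^ d n \<le> real n powr a" unfolding a_def using lam1 elim d by (intro pow) auto
      then have "(lam ^ d n) ^ 4 \<le> (real n powr a) ^ 4" "(lam ^ d n) ^ 2 \<le> (real n powr a) ^ 2"
        using lam1 by (auto intro!: power_mono)
      ultimately show "lam ^ (4 * d n) \<le> real n powr (4 * a)" "lam ^ (2 * d n) \<le> real n powr (2 * a)"
        using elim by (simp_all add: powr_power mult.commute)
    qed (use d[of n] elim \<epsilon> lam1 in auto)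
    finally show ?case .
  qed
  then show "(\<lambda>n. measure_pmf.prob (corr_graphs n lam s)
      {\<omega>. \<bar>err lam s n (d n) (\<beta> n) \<omega>\<bar> > \<epsilon>}) \<longlonglongrightarrow> 0"
    by (intro tendsto_sandwich[OF _ _ tendsto_const lim]) auto
qed

end
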